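(* Let $m\ge 1$ be an integer and let $\delta>-m$ be real. For each of the preferential attachment models (a), (b), (c), there exists a constant $c_1=c_1(m,\delta)>0$ such that, with high probability as $t\to\infty$, the diameter of $G_{m,\delta}(t)$ is at most $c_1\log t$; that is, $\lim_{t\to\infty}\mathbb P\big(\mathrm{diam}(G_{m,\delta}(t))\le c_1\log t\big)=1$.
   Context: Preferential attachment models. For an integer $m\ge1$ and a real $\delta\ge -m$, $G_{m,\delta}(t)$ is a random multigraph with vertex set $[t]=\{1,\dots,t\}$ and $mt$ edges. $D_i(t)$ denotes the degree of vertex $i$ at time $t$ (a self-loop adds 2 to the degree). Model (a), $m=1$: $G_{1,\delta}(1)$ is one vertex with one self-loop. Given $G_{1,\delta}(t)$, a vertex $t+1$ with a single edge is added; the other end point of the edge is $t+1$ itself with probability $\frac{1+\delta}{t(2+\delta)+(1+\delta)}$, and is $i\in[t]$ with probability $\frac{D_i(t)+\delta}{t(2+\delta)+(1+\delta)}$. For $m>1$: put $\delta'=\delta/m$, take $G_{1,\delta'}(mt)$, and for each $1\le j\le t$ merge its vertices $(j-1)m+1,\dots,jm$ into the single vertex $j$ of $G_{m,\delta}(t)$ (keeping all edges). Model (b), $m=1$: start from $G_{1,\delta}(2)$, consisting of vertices $1,2$ joined by 2 edges. For $t\ge2$, given $G_{1,\delta}(t)$, vertex $t+1$ with a single edge is added, attached to $i\in[t]$ with probability $\frac{D_i(t)+\delta}{t(2+\delta)}$. For $m>1$, $G_{m,\delta}(t)$ is obtained from $G_{1,\delta/m}(mt)$ by the same merging as in model (a).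 Model (c), $m\ge1$: start from $G_{m,\delta}(2)$, consisting of vertices $1,2$ joined by $2m$ edges. For $t\ge2$, given $G_{m,\delta}(t)$, vertex $t+1$ is added with $m$ edges whose other end points are chosen independently, each equal to $i\in[t]$ with probability $\frac{D_i(t)+\delta}{t(2m+\delta)}$. Diameter: $\mathrm{diam}(G)=\max\{\mathrm{dist}_G(i,j): i,j\in G,\ \mathrm{dist}_G(i,j)<\infty\}$, with $\mathrm{dist}_G$ the graph distance. A sequence of events $A_t$ occurs with high probability if $\mathbb P(A_t)\to1$ as $t\to\infty$. *)

theory Defs
  imports "HOL-Probability.Probability" "HOL-Library.Multiset" "HOL-Library.Uprod"
    "HOL-Library.Extended_Nat"
begin

section \<open>Multigraphs\<close>

text \<open>
  A finite undirected multigraph is a finite vertex set, always passed explicitly, together with a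
  multiset of unordered pairs; the self-loop at \<open>v\<close> is \<open>Upair v v\<close>.
\<close>

type_synonym 'a edges = "'a uprod multiset"

text \<open>The second summand makes a self-loop contribute 2 to the degree.\<close>

definition vdegree :: "'a edges \<Rightarrow> 'a \<Rightarrow> nat" where
  "vdegree E v = size {#e \<in># E. v \<in> set_uprod e#} + count E (Upair v v)"

definition adj :: "'a edges \<Rightarrow> ('a \<times> 'a) set" where
  "adj E = {(u, v). Upair u v \<in># E}"

text \<open>The infimum of the empty set is \<open>\<infinity>\<close>, the distance between different components.\<close>

definition gdist :: "'a edges \<Rightarrow> 'a \<Rightarrow> 'a \<Rightarrow> enat" where
  "gdist E u v = (INF n \<in> {n. (u, v) \<in> adj E ^^ n}. enat n)"

definition diam :: "'a set \<Rightarrow> 'a edges \<Rightarrow> nat" where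
  "diam V E = Max {n. \<exists>u\<in>V. \<exists>v\<in>V. gdist E u v = enat n}"

section \<open>Preferential attachment\<close>

text \<open>
  Laws of the other end point of an edge added to a graph \<open>E\<close> on \<open>{1..t}\<close> together with the new
  vertex \<open>t + 1\<close>. The lemmas \<open>pmf_attach\<close> and \<open>pmf_attach_loop\<close>, together with
  \<open>PA_graph_PA1_a\<close>, \<open>PA_graph_PA1_b\<close> and \<open>PA_graph_PA_c\<close>, show that \<open>embed_pmf\<close> is
  applied to a genuine probability mass function at every graph that can occur.
\<close>

definition attach :: "nat \<Rightarrow> real \<Rightarrow> nat \<Rightarrow> nat edges \<Rightarrow> nat pmf" where
  "attach m \<delta> t E = embed_pmf (\<lambda>i.
     if i \<in> {1..t} then (real (vdegree E i) + \<delta>) / (real t * (2 * real m + \<delta>)) else 0)"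

definition attach_loop :: "real \<Rightarrow> nat \<Rightarrow> nat edges \<Rightarrow> nat pmf" where
  "attach_loop \<delta> t E = embed_pmf (\<lambda>i.
     if i = t + 1 then (1 + \<delta>) / (real t * (2 + \<delta>) + (1 + \<delta>))
     else if i \<in> {1..t} then (real (vdegree E i) + \<delta>) / (real t * (2 + \<delta>) + (1 + \<delta>))
     else 0)"

text \<open>
  The law of the edges of the graph at time \<open>t\<close>. Times before the start of the process
  (\<open>t = 0\<close>, and for models (b) and (c) also \<open>t = 1\<close>) get the edgeless graph by convention.
\<close>

fun PA1_a :: "real \<Rightarrow> nat \<Rightarrow> nat edges pmf" where
  "PA1_a \<delta> 0 = return_pmf {#}"
| "PA1_a \<delta> (Suc 0) = return_pmf {#Upair 1 1#}"
| "PA1_a \<delta> (Suc (Suc t)) = do {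
     E \<leftarrow> PA1_a \<delta> (Suc t);
     i \<leftarrow> attach_loop \<delta> (Suc t) E;
     return_pmf (add_mset (Upair (Suc (Suc t)) i) E)}"

fun PA1_b :: "real \<Rightarrow> nat \<Rightarrow> nat edges pmf" where
  "PA1_b \<delta> 0 = return_pmf {#}"
| "PA1_b \<delta> (Suc 0) = return_pmf {#}"
| "PA1_b \<delta> (Suc (Suc 0)) = return_pmf (replicate_mset 2 (Upair 1 2))"
| "PA1_b \<delta> (Suc (Suc (Suc t))) = do {
     E \<leftarrow> PA1_b \<delta> (Suc (Suc t));
     i \<leftarrow> attach 1 \<delta> (Suc (Suc t)) E;
     return_pmf (add_mset (Upair (Suc (Suc (Suc t))) i) E)}"

text \<open>
  Vertices \<open>(j - 1) * m + 1, \<dots>, j * m\<close> become the vertex \<open>j\<close>. For \<open>m = 1\<close> this is the identity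
  on positive vertices, so that the definitions of models (a) and (b) cover all \<open>m \<ge> 1\<close>.
\<close>

definition merge :: "nat \<Rightarrow> nat edges \<Rightarrow> nat edges" where
  "merge m E = image_mset (map_uprod (\<lambda>v. (v - 1) div m + 1)) E"

definition PA_a :: "nat \<Rightarrow> real \<Rightarrow> nat \<Rightarrow> nat edges pmf" where
  "PA_a m \<delta> t = map_pmf (merge m) (PA1_a (\<delta> / real m) (m * t))"

definition PA_b :: "nat \<Rightarrow> real \<Rightarrow> nat \<Rightarrow> nat edges pmf" where
  "PA_b m \<delta> t = map_pmf (merge m) (PA1_b (\<delta> / real m) (m * t))"

fun PA_c :: "nat \<Rightarrow> real \<Rightarrow> nat \<Rightarrow> nat edges pmf" where
  "PA_c m \<delta> 0 = return_pmf {#}"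
| "PA_c m \<delta> (Suc 0) = return_pmf {#}"
| "PA_c m \<delta> (Suc (Suc 0)) = return_pmf (replicate_mset (2 * m) (Upair 1 2))"
| "PA_c m \<delta> (Suc (Suc (Suc t))) = do {
     E \<leftarrow> PA_c m \<delta> (Suc (Suc t));
     vs \<leftarrow> replicate_pmf m (attach m \<delta> (Suc (Suc t)) E);
     return_pmf (E + mset (map (Upair (Suc (Suc (Suc t)))) vs))}"

section \<open>The attachment weights are probability distributions\<close>

definition PA_graph :: "nat \<Rightarrow> nat \<Rightarrow> nat edges \<Rightarrow> bool" where
  "PA_graph m t E \<longleftrightarrow> size E = m * t \<and> (\<forall>e\<in>#E. set_uprod e \<subseteq> {1..t}) \<and>
     (\<forall>i\<in>{1..t}. m \<le> vdegree E i)"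

lemma degree_empty [simp]: "vdegree {#} v = 0"
  by (simp add: vdegree_def)

lemma degree_add_mset [simp]:
  "vdegree (add_mset (Upair a b) E) v = of_bool (v = a) + of_bool (v = b) + vdegree E v"
  by (auto simp: vdegree_def)

lemma sum_degree:
  assumes "finite V" "\<forall>e\<in>#E. set_uprod e \<subseteq> V"
  shows "(\<Sum>i\<in>V. vdegree E i) = 2 * size E"
  using assms(2)
proof (induction E)
  case empty
  then show ?case by simp
next
  case (add e E)
  obtain a b where e: "e = Upair a b" by (cases e)
  have "a \<in> V" "b \<in> V" using add.prems e by auto
  then show ?case using add assms(1) e by (simp add: sum.distrib of_bool_def sum.delta)
qed

lemma pmf_embed_finite:
  fixes f :: "'a \<Rightarrow> real"
  assumes "finite A" "\<And>x. x \<in> A \<Longrightarrow> 0 \<le> f x" "\<And>x. x \<notin> A \<Longrightarrow> f x = 0" "sum f A = 1"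
  shows "pmf (embed_pmf f) x = f x"
proof (rule pmf_embed_pmf)
  show nn: "0 \<le> f x" for x using assms(2,3) by (cases "x \<in> A") auto
  have "(\<integral>\<^sup>+x. ennreal (f x) \<partial>count_space UNIV) = (\<Sum>x\<in>A. ennreal (f x))"
    using assms(1,3) by (intro nn_integral_count_space'[where A = A]) auto
  also have "\<dots> = 1" using nn assms(4) by (simp add: sum_ennreal)
  finally show "(\<integral>\<^sup>+x. ennreal (f x) \<partial>count_space UNIV) = 1" .
qed

lemma pmf_attach:
  assumes "PA_graph m t E" "m \<ge> 1" "t \<ge> 1" "\<delta> > - real m"
  shows "pmf (attach m \<delta> t E) i =
    (if i \<in> {1..t} then (real (vdegree E i) + \<delta>) / (real t * (2 * real m + \<delta>)) else 0)"
  unfolding attach_def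
proof (rule pmf_embed_finite[where A = "{1..t}"], goal_cases)
  case (2 i)
  then have "real m \<le> real (vdegree E i)" using assms(1) by (simp add: PA_graph_def)
  then show ?case using assms by (auto intro!: divide_nonneg_nonneg)
next
  case 4
  have "(\<Sum>i=1..t. vdegree E i) = 2 * (m * t)"
    using sum_degree[of "{1..t}" E] assms(1) by (simp add: PA_graph_def)
  then have "(\<Sum>i=1..t. real (vdegree E i) + \<delta>) = real t * (2 * real m + \<delta>)"
    by (simp add: sum.distrib algebra_simps flip: of_nat_sum)
  moreover have "real t * (2 * real m + \<delta>) \<noteq> 0" using assms by auto
  ultimately show ?case by (simp flip: sum_divide_distrib)
qed auto

lemma pmf_attach_loop:
  assumes "PA_graph 1 t E" "\<delta> > - 1"
  shows "pmf (attach_loop \<delta> t E) i =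
    (if i = t + 1 then (1 + \<delta>) / (real t * (2 + \<delta>) + (1 + \<delta>))
     else if i \<in> {1..t} then (real (vdegree E i) + \<delta>) / (real t * (2 + \<delta>) + (1 + \<delta>))
     else 0)"
  unfolding attach_loop_def
proof (rule pmf_embed_finite[where A = "{1..Suc t}"], goal_cases)
  case (2 i)
  have "1 \<le> real (vdegree E i)" if "i \<in> {1..t}" using assms(1) that by (auto simp: PA_graph_def)
  then have "0 \<le> real (vdegree E i) + \<delta>" if "i \<in> {1..t}" using that assms(2) by fastforce
  moreover have "0 \<le> real t * (2 + \<delta>) + (1 + \<delta>)"
    using assms(2) by (intro add_nonneg_nonneg[OF mult_nonneg_nonneg]) auto
  ultimately show ?case using assms(2) by auto
next
  case 4
  let ?f = "\<lambda>i. if i = t + 1 then (1 + \<delta>) / (real t * (2 + \<delta>) + (1 + \<delta>))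
     else if i \<in> {1..t} then (real (vdegree E i) + \<delta>) / (real t * (2 + \<delta>) + (1 + \<delta>))
     else 0"
  have "(\<Sum>i=1..t. vdegree E i) = 2 * t"
    using sum_degree[of "{1..t}" E] assms(1) by (simp add: PA_graph_def)
  then have s: "(\<Sum>i=1..t. real (vdegree E i) + \<delta>) = real t * (2 + \<delta>)"
    by (simp add: sum.distrib algebra_simps flip: of_nat_sum)
  have "real t * (2 + \<delta>) + (1 + \<delta>) > 0" using assms(2) by (intro add_nonneg_pos[OF mult_nonneg_nonneg]) auto
  moreover have "sum ?f {1..t} = real t * (2 + \<delta>) / (real t * (2 + \<delta>) + (1 + \<delta>))"
    by (simp flip: s sum_divide_distrib)
  ultimately show ?case by (simp flip: add_divide_distrib)
qed auto

lemma degree_mono: "vdegree E v \<le> vdegree (E + F) v"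
  by (simp add: vdegree_def)

lemma degree_star:
  "vdegree (E + mset (map (Upair a) vs)) a = vdegree E a + length vs + count_list vs a"
  by (induction vs) auto

lemma PA_graph_step:
  assumes "PA_graph m t E" "length vs = m" "set vs \<subseteq> {1..Suc t}"
  shows "PA_graph m (Suc t) (E + mset (map (Upair (Suc t)) vs))"
  unfolding PA_graph_def
proof (intro conjI ballI)
  fix i assume i: "i \<in> {1..Suc t}"
  show "m \<le> vdegree (E + mset (map (Upair (Suc t)) vs)) i"
  proof (cases "i = Suc t")
    case True
    then show ?thesis using assms(2) degree_star[of E "Suc t" vs] by simp
  next
    case False
    then have "m \<le> vdegree E i" using assms(1) i by (simp add: PA_graph_def)
    then show ?thesis using degree_mono[of E i] order_trans by meson
  qed
next
  fix e assume "e \<in># E + mset (map (Upair (Suc t)) vs)"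
  then consider "e \<in># E" | v where "v \<in> set vs" "e = Upair (Suc t) v" by auto
  then show "set_uprod e \<subseteq> {1..Suc t}"
  proof cases
    case 1
    then have "set_uprod e \<subseteq> {1..t}" using assms(1) by (simp add: PA_graph_def)
    then show ?thesis by auto
  next
    case 2
    then show ?thesis using assms(3) by auto
  qed
qed (use assms in \<open>simp add: PA_graph_def\<close>)

lemma PA_graph_start: "PA_graph m (Suc (Suc 0)) (replicate_mset (2 * m) (Upair 1 2))"
proof -
  have "vdegree (replicate_mset k (Upair 1 2)) i = k" if "i \<in> {1..2}" for i k :: nat
    using that by (induction k) auto
  then show ?thesis by (auto simp: PA_graph_def split: if_splits)
qed

lemma set_attach:
  assumes "PA_graph m t E" "m \<ge> 1" "t \<ge> 1" "\<delta> > - real m"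
  shows "set_pmf (attach m \<delta> t E) \<subseteq> {1..t}"
  by (auto simp: set_pmf_eq pmf_attach[OF assms] split: if_splits)

lemma set_attach_loop:
  assumes "PA_graph 1 t E" "\<delta> > - 1"
  shows "set_pmf (attach_loop \<delta> t E) \<subseteq> {1..Suc t}"
  by (auto simp: set_pmf_eq pmf_attach_loop[OF assms] split: if_splits)

lemma PA_graph_PA1_a:
  assumes "\<delta> > - 1" "t \<ge> 1" "E \<in> set_pmf (PA1_a \<delta> t)"
  shows "PA_graph 1 t E"
  using assms
proof (induction \<delta> t arbitrary: E rule: PA1_a.induct)
  case (3 \<delta> t)
  then obtain F i where F: "F \<in> set_pmf (PA1_a \<delta> (Suc t))" "i \<in> set_pmf (attach_loop \<delta> (Suc t) F)"
    and E: "E = add_mset (Upair (Suc (Suc t)) i) F" by auto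
  have G: "PA_graph 1 (Suc t) F" using 3 F by simp
  have "i \<in> {1..Suc (Suc t)}" using set_attach_loop[OF G, of \<delta>] F(2) 3(2) by auto
  with PA_graph_step[OF G, of "[i]"] E show ?case by auto
qed (auto simp: PA_graph_def)

lemma PA_graph_PA1_b:
  assumes "\<delta> > - 1" "t \<ge> 2" "E \<in> set_pmf (PA1_b \<delta> t)"
  shows "PA_graph 1 t E"
  using assms
proof (induction \<delta> t arbitrary: E rule: PA1_b.induct)
  case (3 \<delta>)
  then show ?case using PA_graph_start[of 1] by simp
next
  case (4 \<delta> t)
  then obtain F i where F: "F \<in> set_pmf (PA1_b \<delta> (Suc (Suc t)))"
      "i \<in> set_pmf (attach 1 \<delta> (Suc (Suc t)) F)"
    and E: "E = add_mset (Upair (Suc (Suc (Suc t))) i) F" by auto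
  have G: "PA_graph 1 (Suc (Suc t)) F" using 4 F by simp
  have "i \<in> {1..Suc (Suc t)}" using set_attach[OF G, of \<delta>] F(2) 4(2) by auto
  with PA_graph_step[OF G, of "[i]"] E show ?case by auto
qed auto

lemma PA_graph_PA_c:
  assumes "m \<ge> 1" "\<delta> > - real m" "t \<ge> 2" "E \<in> set_pmf (PA_c m \<delta> t)"
  shows "PA_graph m t E"
  using assms
proof (induction m \<delta> t arbitrary: E rule: PA_c.induct)
  case (3 m \<delta>)
  then show ?case using PA_graph_start[of m] by simp
next
  case (4 m \<delta> t)
  then obtain F vs where F: "F \<in> set_pmf (PA_c m \<delta> (Suc (Suc t)))"
      "vs \<in> set_pmf (replicate_pmf m (attach m \<delta> (Suc (Suc t)) F))"
    and E: "E = F + mset (map (Upair (Suc (Suc (Suc t)))) vs)" by auto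
  have G: "PA_graph m (Suc (Suc t)) F" using 4 F by simp
  have "length vs = m" "set vs \<subseteq> {1..Suc (Suc t)}"
    using set_attach[OF G, of \<delta>] F(2) 4(2,3) by (auto simp: set_replicate_pmf)
  with PA_graph_step[OF G, of vs] E show ?case by fastforce
qed auto

end

theory Submission
  imports Defs
begin

text \<open>
  From every vertex follow edges to smaller vertices until a vertex without smaller neighbours
  (a root) is reached, and let \<open>depth v\<close> be the least length of such a chain. In each of the
  models the potential \<open>\<Sum>v. (D\<^sub>v(t) + \<delta>) * 2 ^ depth v\<close> grows in one step in expectation by a factor
  at most \<open>1 + c / t\<close>: the end point of a new edge is chosen proportionally to \<open>D\<^sub>v(t) + \<delta>\<close>, and
  the new vertex is at most one step deeper than that end point. Hence the expected potential is
  polynomial in \<open>t\<close>, and by Markov's inequality all depths are \<open>O(log t)\<close> with high probability.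

  In models (b) and (c) vertex 1 is the only root, and merging does not increase distances.
  In model (a) with \<open>m = 1\<close> every component is a tree up to loops, so it has only one root. In
  model (a) with \<open>m \<ge> 2\<close> the vertex \<open>j\<close> is a root with probability \<open>O(1 / j\<^sup>2)\<close>, since it needs two
  loops, so with probability close to 1 all roots are among the first \<open>K\<close> vertices. Which of these
  are connected to each other is, with probability close to 1, settled by some fixed time \<open>S\<close>, and
  then their distances are bounded by a constant that depends only on \<open>S\<close>.
\<close>

section \<open>Descending chains\<close>

text \<open>The strict inequality discards self-loops, so a vertex with only loops and edges to
  larger vertices counts as a root.\<close>

definition lower :: "nat edges \<Rightarrow> nat \<Rightarrow> nat set" where
  "lower E v = {k. k < v \<and> Upair v k \<in># E}"

lemma finite_lower [simp]: "finite (lower E v)"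
  unfolding lower_def by (rule finite_subset[of _ "{..<v}"]) auto

lemma lower_less: "k \<in> lower E v \<Longrightarrow> k < v"
  by (simp add: lower_def)

lemma lower_mono: "E \<subseteq># F \<Longrightarrow> lower E v \<subseteq> lower F v"
  by (auto simp: lower_def dest: mset_subset_eqD)

function depth :: "nat edges \<Rightarrow> nat \<Rightarrow> nat" where
  "depth E v = (if lower E v = {} then 0 else Suc (Min (depth E ` lower E v)))"
  by auto
termination by (relation "Wellfounded.measure snd") (auto dest: lower_less)

declare depth.simps [simp del]

lemma depth_eq_0_iff: "depth E v = 0 \<longleftrightarrow> lower E v = {}"
  by (subst depth.simps) auto

lemma depth_le: 
  assumes "k \<in> lower E v"
  shows "depth E v \<le> Suc (depth E k)"
proof -
  have "Min (depth E ` lower E v) \<le> depth E k"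
    using assms by (intro Min_le) auto
  then show ?thesis using assms by (subst depth.simps) auto
qed

lemma depth_SucE:
  assumes "lower E v \<noteq> {}"
  obtains k where "k \<in> lower E v" "depth E v = Suc (depth E k)"
proof -
  have "Min (depth E ` lower E v) \<in> (depth E ` lower E v)"
    using assms by (intro Min_in) auto
  then obtain k where "k \<in> lower E v" "Min (depth E ` lower E v) = depth E k" by blast
  moreover have "depth E v = Suc (Min (depth E ` lower E v))"
    using assms by (simp add: depth.simps[of E v])
  ultimately show ?thesis using that by metis
qed

text \<open>Chains from \<open>v\<close> visit only vertices up to \<open>v\<close>. Hence a new
  edge with larger end point \<open>b\<close> leaves all depths below \<open>b\<close>
  unchanged.\<close>

lemma depth_cong:
  assumes "\<And>w. w \<le> v \<Longrightarrow> lower E w = lower F w"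
  shows "depth E v = depth F v"
  using assms
proof (induction v rule: less_induct)
  case (less v)
  have "depth E ` lower E v = depth F ` lower F v"
    using less.prems[of v] less by (intro image_cong) (auto dest!: lower_less)
  then show ?case using less.prems[of v] by (simp add: depth.simps[of _ v])
qed

lemma lower_add_mset_top:
  assumes "i \<le> b"
  shows "lower (add_mset (Upair b i) E) v = lower E v \<union> (if v = b \<and> i < b then {i} else {})"
  using assms by (auto simp: lower_def)

lemma sym_adj: "sym (adj E)"
  unfolding sym_def adj_def mem_Collect_eq prod.case
  by (metis Upair_inject)

lemma sym_relpow: "sym R \<Longrightarrow> sym (R ^^ n)"
proof (induction n)
  case (Suc n)
  then have "(R ^^ Suc n)\<inverse> = R O R ^^ n"
    by (simp add: converse_relcomp sym_conv_converse_eq)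
  then show ?case using relpow_commute[of R n] by (simp only: sym_conv_converse_eq relpow.simps)
qed (auto simp: sym_def)

lemma adj_relpow_sym: "(u, v) \<in> adj E ^^ n \<Longrightarrow> (v, u) \<in> adj E ^^ n"
  by (meson sym_adj sym_relpow symD)

lemma adj_rtrancl_sym: "(u, v) \<in> (adj E)\<^sup>* \<Longrightarrow> (v, u) \<in> (adj E)\<^sup>*"
  by (meson sym_adj sym_rtrancl symD)

lemma adj_mono: "E \<subseteq># F \<Longrightarrow> adj E \<subseteq> adj F"
  by (auto simp: adj_def dest: mset_subset_eqD)

lemma relpow_subset:
  fixes R S :: "('b \<times> 'b) set"
  shows "R \<subseteq> S \<Longrightarrow> R ^^ n \<subseteq> S ^^ n"
  by (induction n) auto

lemma lower_adj: "k \<in> lower E v \<Longrightarrow> (v, k) \<in> adj E"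
  by (simp add: lower_def adj_def)

text \<open>Iterating \<open>depth_SucE\<close> follows a shortest chain down to a root; since all
  edges lie in \<open>V\<close>, so does the chain.\<close>

lemma depth_path:
  assumes "v \<in> V" "\<forall>e\<in>#E. set_uprod e \<subseteq> V"
  obtains r where "r \<in> V" "lower E r = {}" "(v, r) \<in> adj E ^^ depth E v"
  using assms(1)
proof (induction v arbitrary: thesis rule: less_induct)
  case (less v)
  show ?case
  proof (cases "lower E v = {}")
    case True
    with less(2)[of v] less(3) show ?thesis by (auto simp: depth_eq_0_iff[THEN iffD2])
  next
    case False
    then obtain k where k: "k \<in> lower E v" "depth E v = Suc (depth E k)" by (rule depth_SucE)
    have "k \<in> V" using k(1) assms(2) by (fastforce simp: lower_def)
    with less(1)[of k] k(1) obtain r where "r \<in> V" "lower E r = {}" "(k, r) \<in> adj E ^^ depth E k"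
      by (auto simp: lower_less)
    then show ?thesis using less(2) relpow_Suc_I2[OF lower_adj[OF k(1)]] k(2) by metis
  qed
qed

text \<open>With at most one smaller neighbour per vertex the descending chain is forced. The two
  ends of an edge have the same chain end, so this end is constant on connected components.\<close>

lemma common_root:
  assumes uniq: "\<And>v k l. k \<in> lower E v \<Longrightarrow> l \<in> lower E v \<Longrightarrow> k = l"
    and "(u, v) \<in> (adj E)\<^sup>*"
  obtains r where "(u, r) \<in> adj E ^^ depth E u" "(v, r) \<in> adj E ^^ depth E v"
proof -
  \<comment> \<open>At a vertex without smaller neighbours \<open>g\<close> is arbitrary. Since
    \<open>root\<close> iterates it exactly \<open>depth E v\<close> times, it is never applied
    there.\<close>
  define g where "g v = (SOME k. k \<in> lower E v)" for v
  define root where "root v = (g ^^ depth E v) v" for v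
  have step: "depth E v = Suc (depth E k) \<and> g v = k" if "k \<in> lower E v" for v k
  proof -
    obtain l where "l \<in> lower E v" "depth E v = Suc (depth E l)"
      using \<open>k \<in> lower E v\<close> by (metis depth_SucE empty_iff)
    moreover have "g v \<in> lower E v" unfolding g_def using \<open>k \<in> lower E v\<close> by (rule someI)
    ultimately show ?thesis using uniq that by metis
  qed
  have root_step: "root v = root k" if "k \<in> lower E v" for v k
    using step[OF that] by (simp add: root_def funpow_swap1)
  have path: "(v, root v) \<in> adj E ^^ depth E v" for v
  proof (induction v rule: less_induct)
    case (less v)
    show ?case
    proof (cases "lower E v = {}")
      case True
      then show ?thesis by (simp add: root_def depth_eq_0_iff[THEN iffD2])
    next
      case False
      then obtain k where k: "k \<in> lower E v" by auto
      with less lower_less root_step[OF k] have "(k, root v) \<in> adj E ^^ depth E k" by metis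
      with relpow_Suc_I2[OF lower_adj[OF k]] show ?thesis using step[OF k] by metis
    qed
  qed
  have "root u = root v" using assms(2)
  proof (induction rule: rtrancl_induct)
    case (step y z)
    consider "y = z" | "y \<in> lower E z" | "z \<in> lower E y"
      using step(2) by (auto simp: adj_def lower_def insert_commute) (metis Upair_inject linorder_neqE_nat)
    then show ?case using step(3) root_step by cases auto
  qed simp
  then show ?thesis using that path by metis
qed

section \<open>Graph distance and diameter\<close>

lemma gdist_le: "(u, v) \<in> adj E ^^ n \<Longrightarrow> gdist E u v \<le> enat n"
  unfolding gdist_def by (intro INF_lower) auto

lemma gdist_finite_iff: "gdist E u v \<noteq> \<infinity> \<longleftrightarrow> (u, v) \<in> (adj E)\<^sup>*"
proof
  show "(u, v) \<in> (adj E)\<^sup>*" if "gdist E u v \<noteq> \<infinity>"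
  proof (rule ccontr)
    assume "(u, v) \<notin> (adj E)\<^sup>*"
    then have "{n. (u, v) \<in> adj E ^^ n} = {}" by (simp add: rtrancl_power)
    then show False using that by (simp add: gdist_def top_enat_def)
  qed
next
  assume "(u, v) \<in> (adj E)\<^sup>*"
  then obtain n where "(u, v) \<in> adj E ^^ n" by (auto simp: rtrancl_power)
  then show "gdist E u v \<noteq> \<infinity>" using gdist_le[of u v n E] by (cases "gdist E u v") auto
qed

text \<open>For \<open>Max\<close> to be meaningful the set of finite distances must be finite and
  nonempty: the bound \<open>N\<close> gives the former, the distance 0 from a vertex to itself the
  latter.\<close>

lemma diam_le:
  assumes "finite V" "V \<noteq> {}"
    and "\<And>u v. u \<in> V \<Longrightarrow> v \<in> V \<Longrightarrow> (u, v) \<in> (adj E)\<^sup>* \<Longrightarrow> \<exists>n. real n \<le> N \<and> (u, v) \<in> adj E ^^ n"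
  shows "real (diam V E) \<le> N"
proof -
  let ?D = "{n. \<exists>u\<in>V. \<exists>v\<in>V. gdist E u v = enat n}"
  have le: "real n \<le> N" if "n \<in> ?D" for n
  proof -
    obtain u v where uv: "u \<in> V" "v \<in> V" "gdist E u v = enat n" using \<open>n \<in> ?D\<close> by auto
    then obtain k where "real k \<le> N" "(u, v) \<in> adj E ^^ k"
      using assms(3) gdist_finite_iff[of E u v] by auto
    moreover from gdist_le[OF this(2)] have "n \<le> k" using uv by simp
    ultimately show ?thesis by simp
  qed
  have "finite ?D"
  proof (rule finite_subset)
    show "?D \<subseteq> {..nat \<lfloor>N\<rfloor>}" using le le_nat_floor by blast
  qed simp
  moreover obtain v where "v \<in> V" using assms(2) by auto
  then have "gdist E v v = enat 0"
    using gdist_le[of v v 0 E] by (simp add: zero_enat_def[symmetric])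
  with \<open>v \<in> V\<close> have "?D \<noteq> {}" by blast
  ultimately show ?thesis unfolding diam_def using le Max_in by blast
qed

text \<open>Vertex maps send walks to walks of the same length; for the block map this says that
  merging does not increase distances.\<close>

lemma adj_image_relpow:
  assumes "(u, v) \<in> adj E ^^ n"
  shows "(f u, f v) \<in> adj (image_mset (map_uprod f) E) ^^ n"
  using assms
proof (induction n arbitrary: v)
  case (Suc n)
  then obtain w where w: "(u, w) \<in> adj E ^^ n" "Upair w v \<in># E" by (auto simp: adj_def)
  have "map_uprod f (Upair w v) \<in># image_mset (map_uprod f) E" using w(2) by (simp del: map_uprod_simps) 
  then have "(f w, f v) \<in> adj (image_mset (map_uprod f) E)" by (simp add: adj_def)
  with Suc.IH[OF w(1)] show ?case by auto
qed auto

lemma diam_le_center: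
  assumes "finite V" "V \<noteq> {}"
    and "\<And>u. u \<in> V \<Longrightarrow> \<exists>n. real n \<le> N \<and> (u, r) \<in> adj E ^^ n"
  shows "real (diam V E) \<le> 2 * N"
proof (rule diam_le[OF assms(1,2)])
  fix u v assume uv: "u \<in> V" "v \<in> V"
  obtain k where k: "real k \<le> N" "(u, r) \<in> adj E ^^ k" using assms(3)[OF uv(1)] by blast
  obtain l where l: "real l \<le> N" "(v, r) \<in> adj E ^^ l" using assms(3)[OF uv(2)] by blast
  have "(u, v) \<in> adj E ^^ (k + l)" using k(2) adj_relpow_sym[OF l(2)] by (auto simp: relpow_add)
  moreover have "real (k + l) \<le> 2 * N" using k(1) l(1) by simp
  ultimately show "\<exists>n. real n \<le> 2 * N \<and> (u, v) \<in> adj E ^^ n" by blast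
qed

section \<open>Expectations and tail bounds\<close>

lemma expectation_bind_pmf:
  fixes f :: "'b \<Rightarrow> real"
  assumes "finite (set_pmf M)" "\<And>x. x \<in> set_pmf M \<Longrightarrow> finite (set_pmf (K x))"
  shows "measure_pmf.expectation (bind_pmf M K) f =
    measure_pmf.expectation M (\<lambda>x. measure_pmf.expectation (K x) f)"
  by (subst pmf_expectation_bind[of "set_pmf M"], use assms in simp_all)
    (subst integral_measure_pmf[of "set_pmf M"], use assms in simp_all)

lemma expectation_pmf_mono:
  fixes f g :: "'a \<Rightarrow> real"
  assumes "finite (set_pmf M)" "\<And>x. x \<in> set_pmf M \<Longrightarrow> f x \<le> g x"
  shows "measure_pmf.expectation M f \<le> measure_pmf.expectation M g"
  using assms by (intro integral_mono_AE) (auto simp: AE_measure_pmf_iff integrable_measure_pmf_finite)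

lemma expectation_bind_le:
  fixes f :: "'b \<Rightarrow> real"
  assumes "finite (set_pmf M)" "\<And>x. x \<in> set_pmf M \<Longrightarrow> finite (set_pmf (K x))"
    and "\<And>x. x \<in> set_pmf M \<Longrightarrow> measure_pmf.expectation (K x) f \<le> c * g x"
  shows "measure_pmf.expectation (bind_pmf M K) f \<le> c * measure_pmf.expectation M g"
  using expectation_pmf_mono[OF assms(1,3)] assms by (simp add: expectation_bind_pmf)

lemma finite_set_replicate_pmf: "finite (set_pmf p) \<Longrightarrow> finite (set_pmf (replicate_pmf n p))"
  using finite_lists_length_eq[of "set_pmf p" n] by (simp add: set_replicate_pmf lists_eq_set conj_commute)

text \<open>Linearity of expectation over \<open>n\<close> independent draws, used for the
  \<open>m\<close> edges that model (c) adds in one step.\<close>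

lemma expectation_replicate_sum:
  fixes g :: "'a \<Rightarrow> real"
  assumes fin: "finite (set_pmf p)"
  shows "measure_pmf.expectation (replicate_pmf n p) (\<lambda>xs. \<Sum>x\<leftarrow>xs. g x) =
    real n * measure_pmf.expectation p g"
proof (induction n)
  case (Suc n)
  have fin': "finite (set_pmf (replicate_pmf n p))" by (rule finite_set_replicate_pmf[OF fin])
  have "measure_pmf.expectation (replicate_pmf (Suc n) p) (\<lambda>xs. \<Sum>x\<leftarrow>xs. g x) =
    measure_pmf.expectation p (\<lambda>x. measure_pmf.expectation (replicate_pmf n p) (\<lambda>xs. g x + (\<Sum>x\<leftarrow>xs. g x)))"
    using fin fin' by (simp add: expectation_bind_pmf)
  also have "\<dots> = measure_pmf.expectation p (\<lambda>x. g x + real n * measure_pmf.expectation p g)"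
    using fin' Suc.IH by (simp add: integrable_measure_pmf_finite)
  also have "\<dots> = real (Suc n) * measure_pmf.expectation p g"
    using fin by (simp add: integrable_measure_pmf_finite algebra_simps)
  finally show ?case .
qed simp

text \<open>Integrates a one-step bound on the conditional probability; the indicator expresses that
  \<open>B\<close> can be reached only from \<open>A\<close>.\<close>

lemma prob_bind_le:
  assumes "finite (set_pmf M)" "\<And>x. x \<in> set_pmf M \<Longrightarrow> finite (set_pmf (K x))"
    and "\<And>x. x \<in> set_pmf M \<Longrightarrow> measure_pmf.prob (K x) B \<le> c * indicator A x"
  shows "measure_pmf.prob (bind_pmf M K) B \<le> c * measure_pmf.prob M A"
  using expectation_bind_le[of M K "indicator B" c "indicator A"] assms by simp

lemma whp:
  assumes "(\<lambda>t. measure_pmf.prob (M t) (B t)) \<longlonglongrightarrow> 0"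
    and "\<forall>\<^sub>F t in sequentially. \<forall>x \<in> set_pmf (M t). x \<notin> B t \<longrightarrow> x \<in> A t"
  shows "(\<lambda>t. measure_pmf.prob (M t) (A t)) \<longlonglongrightarrow> 1"
proof (rule tendsto_sandwich)
  show "(\<lambda>t. 1 - measure_pmf.prob (M t) (B t)) \<longlonglongrightarrow> 1"
    using tendsto_diff[OF tendsto_const assms(1), of 1] by simp
  show "\<forall>\<^sub>F t in sequentially. 1 - measure_pmf.prob (M t) (B t) \<le> measure_pmf.prob (M t) (A t)"
    using assms(2)
  proof eventually_elim
    case (elim t)
    have "1 - measure_pmf.prob (M t) (B t) = measure_pmf.prob (M t) (- B t)"
      using measure_pmf.prob_compl[of "B t" "M t"] by (simp add: Compl_eq_Diff_UNIV)
    also have "\<dots> \<le> measure_pmf.prob (M t) (A t)"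
      using elim by (intro measure_pmf.finite_measure_mono_AE) (auto simp: AE_measure_pmf_iff)
    finally show ?case .
  qed
qed auto

text \<open>With \<open>k\<close> the ceiling of \<open>c\<close>, Bernoulli's inequality bounds the
  growth factor by \<open>(1 + 1 / t) ^ k\<close>, and these factors telescope because
  \<open>(1 + 1 / t) * t = t + 1\<close>.\<close>

lemma polynomial_growth:
  fixes a :: "nat \<Rightarrow> real"
  assumes "\<And>t. t \<ge> t0 \<Longrightarrow> a (Suc t) \<le> (1 + c / real t) * a t" "\<And>t. t \<ge> t0 \<Longrightarrow> 0 \<le> a t" "t0 \<ge> 1"
  obtains C k where "\<And>t. t \<ge> t0 \<Longrightarrow> a t \<le> C * real t ^ k"
proof -
  define k where "k = nat \<lceil>c\<rceil>"
  have k: "c \<le> real k" unfolding k_def by linarith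
  have "a t \<le> a t0 * real t ^ k" if "t \<ge> t0" for t
    using that
  proof (induction t rule: dec_induct)
    case base
    have "1 \<le> real t0 ^ k" using assms(3) by simp
    then show ?case using assms(2)[of t0] using mult_left_mono[of 1 "real t0 ^ k" "a t0"] by simp
  next
    case (step t)
    have t: "t \<ge> 1" using step.hyps assms(3) by simp
    have "a (Suc t) \<le> (1 + c / real t) * a t" using step.hyps by (intro assms(1)) simp
    also have "\<dots> \<le> (1 + 1 / real t) ^ k * a t"
    proof (rule mult_right_mono)
      have "1 + c / real t \<le> 1 + real k * (1 / real t)" using k by (simp add: divide_right_mono)
      also have "\<dots> \<le> (1 + 1 / real t) ^ k" by (rule Bernoulli_inequality) (rule order_trans[of "-1" 0], auto)
      finally show "1 + c / real t \<le> (1 + 1 / real t) ^ k" .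
    qed (use step.hyps assms(2)[of t] in simp)
    also have "\<dots> \<le> (1 + 1 / real t) ^ k * (a t0 * real t ^ k)"
      using step.IH by (intro mult_left_mono) auto
    also have "\<dots> = a t0 * ((1 + 1 / real t) * real t) ^ k" by (simp add: power_mult_distrib)
    also have "(1 + 1 / real t) * real t = real (Suc t)" using t by (simp add: field_simps)
    finally show ?case .
  qed
  with that[of "a t0" k] show thesis by blast
qed

text \<open>As \<open>W\<close> dominates \<open>\<alpha> * 2 ^ d x v\<close> for every
  \<open>v\<close>, one application of Markov's inequality controls all vertices at once. The
  threshold is one power of \<open>t\<close> above the order \<open>t ^ k\<close> of the
  expectation, which leaves a bound of order \<open>1 / t\<close>.\<close>

lemma depth_tail:
  fixes W :: "nat \<Rightarrow> 'a \<Rightarrow> real" and d :: "'a \<Rightarrow> nat \<Rightarrow> nat"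
  assumes fin: "\<And>t. t \<ge> t0 \<Longrightarrow> finite (set_pmf (M t))"
    and dom: "\<And>t x v. t \<ge> t0 \<Longrightarrow> x \<in> set_pmf (M t) \<Longrightarrow> v \<in> {1..t} \<Longrightarrow> \<alpha> * 2 ^ d x v \<le> W t x"
    and growth: "\<And>t. t \<ge> t0 \<Longrightarrow>
      measure_pmf.expectation (M (Suc t)) (W (Suc t)) \<le> (1 + c / real t) * measure_pmf.expectation (M t) (W t)"
    and "\<alpha> > 0" "t0 \<ge> 1"
  obtains b where "b > 0"
    "(\<lambda>t. measure_pmf.prob (M t) {x. \<exists>v\<in>{1..t}. real (d x v) > b * ln (real t)}) \<longlonglongrightarrow> 0"
proof -
  have nonneg: "0 \<le> W t x" if "t \<ge> t0" "x \<in> set_pmf (M t)" for t x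
  proof -
    have "0 \<le> \<alpha> * 2 ^ d x 1" using assms(4) by simp
    also have "\<dots> \<le> W t x" using that assms(5) by (intro dom) auto
    finally show ?thesis .
  qed
  have E_nonneg: "0 \<le> measure_pmf.expectation (M t) (W t)" if "t \<ge> t0" for t
    by (rule integral_nonneg_AE) (simp add: AE_measure_pmf_iff nonneg[OF that])
  obtain C k where Ck: "\<And>t. t \<ge> t0 \<Longrightarrow> measure_pmf.expectation (M t) (W t) \<le> C * real t ^ k"
    using polynomial_growth[of t0 "\<lambda>t. measure_pmf.expectation (M t) (W t)" c, OF growth E_nonneg assms(5)]
    by metis
  \<comment> \<open>Chosen so that a depth of \<open>b * ln t\<close> corresponds to
    \<open>2 ^ (b * ln t) = t ^ (k + 1)\<close>.\<close>
  define b where "b = (real k + 1) / ln 2"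
  have bound: "measure_pmf.prob (M t) {x. \<exists>v\<in>{1..t}. real (d x v) > b * ln (real t)} \<le> C / \<alpha> / real t"
    if t: "t \<ge> t0" for t
  proof -
    have t1: "t \<ge> 1" using t assms(5) by simp
    let ?y = "\<alpha> * real t ^ Suc k"
    have "measure_pmf.prob (M t) {x. \<exists>v\<in>{1..t}. real (d x v) > b * ln (real t)}
        \<le> measure_pmf.prob (M t) {x. ?y \<le> W t x}"
    proof (rule measure_pmf.finite_measure_mono_AE, unfold AE_measure_pmf_iff, safe)
      fix x v assume x: "x \<in> set_pmf (M t)" and v: "v \<in> {1..t}" and d: "b * ln (real t) < real (d x v)"
      have "ln (real t ^ Suc k) = real (Suc k) * ln (real t)" using t1 by (intro ln_realpow)
      also have "\<dots> = b * ln (real t) * ln 2" by (simp add: b_def)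
      also have "\<dots> \<le> real (d x v) * ln 2" using d by (intro mult_right_mono) auto
      also have "\<dots> = ln (2 ^ d x v)" by (simp add: ln_realpow)
      finally have "real t ^ Suc k \<le> 2 ^ d x v" using t1 by (subst (asm) ln_le_cancel_iff) auto
      then have "?y \<le> \<alpha> * 2 ^ d x v" using assms(4) by (intro mult_left_mono) auto
      also have "\<dots> \<le> W t x" using dom[OF t x v] .
      finally show "?y \<le> W t x" .
    qed simp
    also have "\<dots> \<le> measure_pmf.expectation (M t) (W t) / ?y"
    proof -
      have "?y > 0" using t1 assms(4) by simp
      moreover have "AE x in measure_pmf (M t). 0 \<le> W t x"
        using nonneg[OF t] by (simp add: AE_measure_pmf_iff)
      moreover have "integrable (measure_pmf (M t)) (W t)"
        using fin[OF t] by (rule integrable_measure_pmf_finite)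
      ultimately show ?thesis
        using integral_Markov_inequality_measure[of "measure_pmf (M t)" "W t" UNIV ?y] by simp
    qed
    also have "\<dots> \<le> C * real t ^ k / ?y"
      using Ck[OF t] t1 assms(4) by (intro divide_right_mono) auto
    also have "\<dots> = C / \<alpha> / real t" using t1 by simp
    finally show ?thesis .
  qed
  have "(\<lambda>t. measure_pmf.prob (M t) {x. \<exists>v\<in>{1..t}. real (d x v) > b * ln (real t)}) \<longlonglongrightarrow> 0"
  proof (rule tendsto_sandwich[OF _ _ tendsto_const])
    show "(\<lambda>t. C / \<alpha> / real t) \<longlonglongrightarrow> 0"
      by (rule real_tendsto_divide_at_top[OF tendsto_const filterlim_real_sequentially])
    show "\<forall>\<^sub>F t in sequentially. measure_pmf.prob (M t) {x. \<exists>v\<in>{1..t}. real (d x v) > b * ln (real t)} \<le> C / \<alpha> / real t"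
      using bound by (auto simp: eventually_sequentially)
  qed simp
  moreover have "b > 0" by (simp add: b_def)
  ultimately show thesis using that by blast
qed

section \<open>Model (c)\<close>

text \<open>The depth function is a parameter, so that the same potential serves plain depths in
  models (b) and (c) and depths of merged blocks in model (a).\<close>

definition weight :: "real \<Rightarrow> (nat \<Rightarrow> nat) \<Rightarrow> nat \<Rightarrow> nat edges \<Rightarrow> real" where
  "weight \<delta> d t E = (\<Sum>v=1..t. (real (vdegree E v) + \<delta>) * 2 ^ d v)"

lemma PA_graph_degree: "PA_graph m t E \<Longrightarrow> v \<in> {1..t} \<Longrightarrow> m \<le> vdegree E v"
  by (simp add: PA_graph_def)

lemma PA_graph_edges: "PA_graph m t E \<Longrightarrow> \<forall>e\<in>#E. set_uprod e \<subseteq> {1..t}"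
  by (simp add: PA_graph_def)

lemma weight_ge:
  assumes "PA_graph m t E" "\<delta> > - real m" "v \<in> {1..t}"
  shows "(real m + \<delta>) * 2 ^ d v \<le> weight \<delta> d t E"
proof -
  have D: "real m \<le> real (vdegree E u)" if "u \<in> {1..t}" for u
    using PA_graph_degree[OF assms(1) that] by simp
  have "(real m + \<delta>) * 2 ^ d v \<le> (real (vdegree E v) + \<delta>) * 2 ^ d v"
    using D[OF assms(3)] by (intro mult_right_mono) auto
  also have "\<dots> \<le> weight \<delta> d t E"
    unfolding weight_def
  proof (rule member_le_sum[OF assms(3)])
    fix u assume "u \<in> {1..t} - {v}"
    then show "0 \<le> (real (vdegree E u) + \<delta>) * 2 ^ d u" using D[of u] assms(2) by simp
  qed simp
  finally show ?thesis .
qed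

lemma vdegree_outside:
  assumes "\<forall>e\<in>#E. set_uprod e \<subseteq> V" "v \<notin> V"
  shows "vdegree E v = 0"
proof -
  have "{#e \<in># E. v \<in> set_uprod e#} = {#}" 
    by (subst filter_mset_cong[of E E _ "\<lambda>_. False"]) (use assms in auto)
  moreover have "Upair v v \<notin># E" using assms by fastforce
  ultimately show ?thesis by (simp add: vdegree_def count_eq_zero_iff)
qed

lemma degree_star_gen:
  "vdegree (E + mset (map (Upair a) vs)) v = vdegree E v + of_bool (v = a) * length vs + count_list vs v"
  by (induction vs) auto

lemma sum_list_eq_sum_count:
  fixes f :: "'a \<Rightarrow> real"
  assumes "set xs \<subseteq> A" "finite A"
  shows "(\<Sum>x\<leftarrow>xs. f x) = (\<Sum>x\<in>A. real (count_list xs x) * f x)"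
  using assms(1)
proof (induction xs)
  case (Cons y xs)
  have "real (count_list (y # xs) x) * f x = (if x = y then f x else 0) + real (count_list xs x) * f x" for x
    by (simp add: algebra_simps)
  then show ?case using Cons assms(2) by (simp add: sum.distrib)
qed simp

lemma lower_star:
  assumes "\<And>v. v \<in> set vs \<Longrightarrow> v < a"
  shows "lower (E + mset (map (Upair a) vs)) w = lower E w \<union> (if w = a then set vs else {})"
  using assms by (force simp: lower_def)

text \<open>Each chosen end point gains one unit of degree, which adds the sum on the right once.
  The new vertex has degree \<open>m\<close> and its power of 2 is at most twice that sum, whence
  the term \<open>2 * (real m + \<delta>)\<close>.\<close>

lemma weight_star:
  assumes G: "PA_graph m t E" and vs: "length vs = m" "set vs \<subseteq> {1..t}" and m: "m \<ge> 1" "\<delta> > - real m"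
  defines "E' \<equiv> E + mset (map (Upair (Suc t)) vs)"
  shows "weight \<delta> (depth E') (Suc t) E' \<le> weight \<delta> (depth E) t E
    + (1 + 2 * (real m + \<delta>)) * (\<Sum>x\<leftarrow>vs. 2 ^ depth E x)"
proof -
  let ?S = "\<Sum>x\<leftarrow>vs. 2 ^ depth E x :: real"
  have less: "\<And>v. v \<in> set vs \<Longrightarrow> v < Suc t" using vs(2) by auto
  have depth_old: "depth E' v = depth E v" if "v \<le> t" for v
    
    using that unfolding E'_def by (intro depth_cong, subst lower_star[OF less]) auto
  have deg_old: "vdegree E' v = vdegree E v + count_list vs v" if "v \<le> t" for v
    using that unfolding E'_def degree_star_gen by simp
  have "Suc t \<notin> set vs" using vs(2) by auto
  then have deg_new: "vdegree E' (Suc t) = m"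
    using vdegree_outside[OF PA_graph_edges[OF G]] vs(1) unfolding E'_def degree_star_gen by simp
  \<comment> \<open>Any end point bounds the depth of the new vertex; the first one exists because
    \<open>m \<ge> 1\<close>.\<close>
  have hd: "hd vs \<in> set vs" using vs(1) m(1) by (intro hd_in_set) auto
  have "depth E' (Suc t) \<le> Suc (depth E' (hd vs))"
    
    using hd unfolding E'_def by (intro depth_le, subst lower_star[OF less]) auto
  also have "depth E' (hd vs) = depth E (hd vs)" using less[OF hd] by (intro depth_old) simp
  finally have "(2::real) ^ depth E' (Suc t) \<le> 2 ^ Suc (depth E (hd vs))"
    by (intro power_increasing) auto
  also have "\<dots> \<le> 2 * ?S" using hd by (cases vs) (auto intro!: sum_list_nonneg)
  finally have new: "(real m + \<delta>) * 2 ^ depth E' (Suc t) \<le> (real m + \<delta>) * (2 * ?S)"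
    using m(2) by (intro mult_left_mono) auto
  have "?S = (\<Sum>v=1..t. real (count_list vs v) * 2 ^ depth E v)"
    by (rule sum_list_eq_sum_count[OF vs(2)]) simp
  then have "(\<Sum>v=1..t. (real (vdegree E' v) + \<delta>) * 2 ^ depth E' v) = weight \<delta> (depth E) t E + ?S"
    by (simp add: weight_def depth_old deg_old sum.distrib[symmetric] algebra_simps)
  then have "weight \<delta> (depth E') (Suc t) E' =
      weight \<delta> (depth E) t E + ?S + (real m + \<delta>) * 2 ^ depth E' (Suc t)"
    by (simp add: weight_def deg_new)
  then show ?thesis using new by (simp add: algebra_simps)
qed

lemma PA_c_Suc:
  assumes "t \<ge> 2"
  shows "PA_c m \<delta> (Suc t) = do {
     E \<leftarrow> PA_c m \<delta> t;
     vs \<leftarrow> replicate_pmf m (attach m \<delta> t E);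
     return_pmf (E + mset (map (Upair (Suc t)) vs))}"
proof -
  obtain n where "t = Suc (Suc n)" using assms by (metis add_2_eq_Suc le_iff_add)
  then show ?thesis by simp
qed

lemma finite_set_attach:
  assumes "PA_graph m t E" "m \<ge> 1" "t \<ge> 1" "\<delta> > - real m"
  shows "finite (set_pmf (attach m \<delta> t E))"
  using set_attach[OF assms] by (rule finite_subset) simp

lemma finite_set_PA_c:
  assumes "m \<ge> 1" "\<delta> > - real m" "t \<ge> 2"
  shows "finite (set_pmf (PA_c m \<delta> t))"
  using assms(3)
proof (induction t rule: dec_induct)
  case base
  then show ?case by (simp add: numeral_2_eq_2)
next
  case (step t)
  then show ?case
    using PA_graph_PA_c[OF assms(1,2) step.hyps(1)] finite_set_attach assms
    by (auto simp: PA_c_Suc intro!: finite_set_replicate_pmf finite_set_attach)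
qed

text \<open>The factors \<open>D + \<delta>\<close> in the potential are the attachment
  probabilities up to normalisation, so averaging \<open>2 ^ d\<close> over an end point returns the
  potential itself. This is the reason for the form of \<open>weight\<close>.\<close>

lemma expectation_attach:
  assumes "PA_graph m t E" "m \<ge> 1" "t \<ge> 1" "\<delta> > - real m"
  shows "measure_pmf.expectation (attach m \<delta> t E) (\<lambda>i. 2 ^ d i) =
    weight \<delta> d t E / (real t * (2 * real m + \<delta>))"
proof -
  have "measure_pmf.expectation (attach m \<delta> t E) (\<lambda>i. 2 ^ d i :: real) =
      (\<Sum>i=1..t. 2 ^ d i * pmf (attach m \<delta> t E) i)"
    using set_attach[OF assms] by (intro integral_measure_pmf_real) auto
  also have "\<dots> = weight \<delta> d t E / (real t * (2 * real m + \<delta>))"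
    by (simp add: pmf_attach[OF assms] weight_def sum_divide_distrib mult.commute)
  finally show ?thesis .
qed

text \<open>By \<open>weight_star\<close> each of the \<open>m\<close> end points costs
  \<open>1 + 2 * (m + \<delta>)\<close> times its power of 2, and by
  \<open>expectation_attach\<close> that power averages to the potential divided by
  \<open>t * (2 * m + \<delta>)\<close>.\<close>

lemma PA_c_growth:
  assumes m: "m \<ge> 1" "\<delta> > - real m" and t: "t \<ge> 2"
  defines "c \<equiv> (1 + 2 * (real m + \<delta>)) * real m / (2 * real m + \<delta>)"
  shows "measure_pmf.expectation (PA_c m \<delta> (Suc t)) (\<lambda>E. weight \<delta> (depth E) (Suc t) E)
    \<le> (1 + c / real t) * measure_pmf.expectation (PA_c m \<delta> t) (\<lambda>E. weight \<delta> (depth E) t E)"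
  unfolding PA_c_Suc[OF t]
proof (rule expectation_bind_le[OF finite_set_PA_c[OF m t]])
  fix E assume "E \<in> set_pmf (PA_c m \<delta> t)"
  then have G: "PA_graph m t E" using PA_graph_PA_c m t by blast
  let ?p = "attach m \<delta> t E"
  have t1: "t \<ge> 1" using t by simp
  have fin: "finite (set_pmf ?p)" by (rule finite_set_attach[OF G m(1) t1 m(2)])
  have fin': "finite (set_pmf (replicate_pmf m ?p))" by (rule finite_set_replicate_pmf[OF fin])
  then show "finite (set_pmf (replicate_pmf m ?p \<bind> (\<lambda>vs. return_pmf (E + mset (map (Upair (Suc t)) vs)))))"
    by simp
  have "measure_pmf.expectation (replicate_pmf m ?p \<bind> (\<lambda>vs. return_pmf (E + mset (map (Upair (Suc t)) vs))))
      (\<lambda>E. weight \<delta> (depth E) (Suc t) E) = measure_pmf.expectation (replicate_pmf m ?p)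
      (\<lambda>vs. weight \<delta> (depth (E + mset (map (Upair (Suc t)) vs))) (Suc t) (E + mset (map (Upair (Suc t)) vs)))"
    using fin' by (simp add: expectation_bind_pmf)
  also have "\<dots> \<le> measure_pmf.expectation (replicate_pmf m ?p)
      (\<lambda>vs. weight \<delta> (depth E) t E + (1 + 2 * (real m + \<delta>)) * (\<Sum>x\<leftarrow>vs. 2 ^ depth E x))"
  proof (rule expectation_pmf_mono[OF fin'])
    fix vs assume "vs \<in> set_pmf (replicate_pmf m ?p)"
    then have "length vs = m" "set vs \<subseteq> {1..t}"
      using set_attach[OF G m(1) t1 m(2)] by (auto simp: set_replicate_pmf)
    with weight_star[OF G _ _ m] show "weight \<delta> (depth (E + mset (map (Upair (Suc t)) vs))) (Suc t) (E + mset (map (Upair (Suc t)) vs))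
      \<le> weight \<delta> (depth E) t E + (1 + 2 * (real m + \<delta>)) * (\<Sum>x\<leftarrow>vs. 2 ^ depth E x)" by blast
  qed
  also have "\<dots> = weight \<delta> (depth E) t E + (1 + 2 * (real m + \<delta>)) *
      (real m * (weight \<delta> (depth E) t E / (real t * (2 * real m + \<delta>))))"
    using expectation_replicate_sum[OF fin, of m "\<lambda>x. 2 ^ depth E x"] expectation_attach[OF G m(1) t1 m(2)]
    by (simp add: integrable_measure_pmf_finite[OF fin'])
  also have "\<dots> = (1 + c / real t) * weight \<delta> (depth E) t E"
    by (simp add: c_def algebra_simps)
  finally show "measure_pmf.expectation (replicate_pmf m ?p \<bind> (\<lambda>vs. return_pmf (E + mset (map (Upair (Suc t)) vs))))
      (\<lambda>E. weight \<delta> (depth E) (Suc t) E) \<le> (1 + c / real t) * weight \<delta> (depth E) t E" .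
qed

lemma PA_c_depth_tail:
  assumes m: "m \<ge> 1" "\<delta> > - real m"
  obtains b where "b > 0" "(\<lambda>t. measure_pmf.prob (PA_c m \<delta> t)
    {E. \<exists>v\<in>{1..t}. real (depth E v) > b * ln (real t)}) \<longlonglongrightarrow> 0"
proof -
  have dom: "(real m + \<delta>) * 2 ^ depth E v \<le> weight \<delta> (depth E) t E"
    if "t \<ge> 2" "E \<in> set_pmf (PA_c m \<delta> t)" "v \<in> {1..t}" for t E v
    using that PA_graph_PA_c[OF m] m(2) by (intro weight_ge) auto
  show thesis
    by (rule depth_tail[where M = "PA_c m \<delta>" and W = "\<lambda>t E. weight \<delta> (depth E) t E" and d = depth
        and \<alpha> = "real m + \<delta>" and ?t0.0 = 2, OF finite_set_PA_c[OF m] dom PA_c_growth[OF m] _ _ that])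
      (use m in auto)
qed

text \<open>A new vertex sends its edges to strictly older vertices and edges are never removed, so
  vertex 1 remains the only root.\<close>

lemma PA_c_lower:
  assumes m: "m \<ge> 1" "\<delta> > - real m" and "t \<ge> 2" "E \<in> set_pmf (PA_c m \<delta> t)" "v \<in> {2..t}"
  shows "lower E v \<noteq> {}"
  using assms(3-5)
proof (induction t arbitrary: E v rule: dec_induct)
  case base
  then have "v = 2" "E = replicate_mset (2 * m) (Upair 1 2)" by (auto simp: numeral_2_eq_2)
  then have "1 \<in> lower E v" using m(1) by (auto simp: lower_def)
  then show ?case by auto
next
  case (step t)
  then obtain F vs where F: "F \<in> set_pmf (PA_c m \<delta> t)" "vs \<in> set_pmf (replicate_pmf m (attach m \<delta> t F))"
    and E: "E = F + mset (map (Upair (Suc t)) vs)" by (auto simp: PA_c_Suc)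
  have G: "PA_graph m t F" using PA_graph_PA_c[OF m _ F(1)] step.hyps by simp
  have vs: "length vs = m" "set vs \<subseteq> {1..t}"
    using set_attach[OF G m(1) _ m(2)] F(2) step.hyps by (auto simp: set_replicate_pmf)
  show ?case
  proof (cases "v = Suc t")
    case True
    have "hd vs \<in> set vs" using vs(1) m(1) by (intro hd_in_set) auto
    then have "hd vs \<in> lower E v" using True vs(2) by (auto simp: lower_def E)
    then show ?thesis by auto
  next
    case False
    then have "lower F v \<noteq> {}" using step F by auto
    then show ?thesis using lower_mono[of F E v] E by auto
  qed
qed

lemma PA_c_path_to_1:
  assumes m: "m \<ge> 1" "\<delta> > - real m" and "t \<ge> 2" "E \<in> set_pmf (PA_c m \<delta> t)" "v \<in> {1..t}"
  shows "(v, 1) \<in> adj E ^^ depth E v"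
proof -
  obtain r where "r \<in> {1..t}" "lower E r = {}" "(v, r) \<in> adj E ^^ depth E v"
    using depth_path[OF assms(5)] PA_graph_edges[OF PA_graph_PA_c[OF assms(1-4)]] by blast
  moreover from this have "r = 1" using PA_c_lower[OF assms(1-4), of r] by force
  ultimately show ?thesis by simp
qed

lemma PA_c_diam:
  assumes m: "m \<ge> 1" "\<delta> > - real m"
  shows "\<exists>c>0. (\<lambda>t. measure_pmf.prob (PA_c m \<delta> t) {G. real (diam {1..t} G) \<le> c * ln (real t)}) \<longlonglongrightarrow> 1"
proof -
  obtain b where b: "b > 0" "(\<lambda>t. measure_pmf.prob (PA_c m \<delta> t)
      {E. \<exists>v\<in>{1..t}. real (depth E v) > b * ln (real t)}) \<longlonglongrightarrow> 0"
    using PA_c_depth_tail[OF m] by blast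
  have "(\<lambda>t. measure_pmf.prob (PA_c m \<delta> t) {G. real (diam {1..t} G) \<le> 2 * b * ln (real t)}) \<longlonglongrightarrow> 1"
  proof (rule whp[OF b(2)], intro eventually_sequentiallyI[of 2] ballI impI CollectI)
    fix t E assume t: "2 \<le> t" and E: "E \<in> set_pmf (PA_c m \<delta> t)"
      and small: "E \<notin> {E. \<exists>v\<in>{1..t}. real (depth E v) > b * ln (real t)}"
    have "real (diam {1..t} E) \<le> 2 * (b * ln (real t))"
      using small PA_c_path_to_1[OF m t E] t by (intro diam_le_center[of _ _ 1]) force+
    then show "real (diam {1..t} E) \<le> 2 * b * ln (real t)" by simp
  qed
  with b(1) show ?thesis by (intro exI[of _ "2 * b"]) simp
qed

section \<open>Merging and model (b)\<close>

abbreviation block :: "nat \<Rightarrow> nat \<Rightarrow> nat" where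
  "block m v \<equiv> (v - 1) div m + 1"

text \<open>Every merged vertex has an unmerged representative in range, so bounds for all unmerged
  vertices carry over to the blocks.\<close>

lemma block_first:
  assumes "m \<ge> 1" "j \<in> {1..t}"
  shows "(j - 1) * m + 1 \<in> {1..m * t}" "block m ((j - 1) * m + 1) = j"
proof -
  have "(j - 1) * m + m \<le> t * m" using assms(2) mult_le_mono1[of j t m] by (cases j) auto
  then show "(j - 1) * m + 1 \<in> {1..m * t}" using assms(1) by (simp add: mult.commute)
qed (use assms in auto)

text \<open>For \<open>t \<ge> m\<close> the product \<open>m * t\<close> is at most
  \<open>t ^ 2\<close>, so the change of time costs only a factor 2.\<close>

lemma ln_mult_le:
  assumes "m \<ge> 1" "t \<ge> m"
  shows "ln (real (m * t)) \<le> 2 * ln (real t)"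
  using assms by (simp add: ln_mult)

lemma block_eq_close:
  assumes "block m v = block m w" "m \<ge> 1" "v \<ge> 1"
  shows "w < v + m"
proof -
  have "w - 1 = (w - 1) div m * m + (w - 1) mod m" by simp
  also have "\<dots> < (w - 1) div m * m + m"
    using mod_less_divisor[of m "w - 1"] assms(2) by (intro add_strict_left_mono) simp
  also have "(w - 1) div m * m = (v - 1) div m * m" using assms(1) by simp
  also have "(v - 1) div m * m \<le> v - 1" by simp
  finally show ?thesis using assms(3) by linarith
qed

lemma block_mono: "v \<le> w \<Longrightarrow> block m v \<le> block m w"
  by (simp add: div_le_mono)

lemma card_block_le:
  assumes "m \<ge> 1"
  shows "card {v \<in> {1..s}. block m v = block m s} \<le> m"
proof -
  have "{v \<in> {1..s}. block m v = block m s} \<subseteq> {Suc s - m..<Suc s}"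
    using block_eq_close[of _ m s] assms by fastforce
  then have "card {v \<in> {1..s}. block m v = block m s} \<le> card {Suc s - m..<Suc s}"
    by (intro card_mono) auto
  then show ?thesis by simp
qed

lemma merge_add_mset: "merge m (add_mset (Upair a b) E) = add_mset (Upair (block m a) (block m b)) (merge m E)"
  by (simp add: merge_def)

lemma merge_mono: "E \<subseteq># F \<Longrightarrow> merge m E \<subseteq># merge m F"
  by (simp add: merge_def image_mset_subseteq_mono)

lemma merge_edges:
  assumes "\<forall>e\<in>#E. set_uprod e \<subseteq> V" "e \<in># merge m E"
  shows "set_uprod e \<subseteq> block m ` V"
proof -
  obtain e' where e': "e' \<in># E" "e = map_uprod (block m) e'" using assms(2) by (auto simp: merge_def)
  then show ?thesis using assms(1) by (auto simp: uprod.set_map)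
qed

text \<open>A list of length 1 is a single draw, so model (b) before merging is model (c) with one
  edge per step and inherits its depth bounds.\<close>

lemma PA1_b_eq_PA_c: "PA1_b \<delta> t = PA_c 1 \<delta> t"
  by (induction \<delta> t rule: PA1_b.induct) (simp_all add: bind_assoc_pmf bind_return_pmf numeral_2_eq_2)

text \<open>Walks to vertex 1 in the graph at time \<open>m * t\<close> project to walks to its
  block. The factor 4 consists of 2 for passing through this centre and 2 from
  \<open>ln_mult_le\<close>.\<close>

lemma PA_b_diam:
  assumes m: "m \<ge> 1" "\<delta> > - real m"
  shows "\<exists>c>0. (\<lambda>t. measure_pmf.prob (PA_b m \<delta> t) {G. real (diam {1..t} G) \<le> c * ln (real t)}) \<longlonglongrightarrow> 1"
proof -
  define \<delta>' where "\<delta>' = \<delta> / real m"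
  have \<delta>': "\<delta>' > - real 1" using m by (simp add: \<delta>'_def field_simps)
  obtain b where b: "b > 0" "(\<lambda>t. measure_pmf.prob (PA_c 1 \<delta>' t)
      {E. \<exists>v\<in>{1..t}. real (depth E v) > b * ln (real t)}) \<longlonglongrightarrow> 0"
    using PA_c_depth_tail[of 1 \<delta>'] \<delta>' by auto
  have "filterlim (\<lambda>t. m * t) sequentially sequentially"
    using m(1) by (intro filterlim_subseq strict_monoI) auto
  from filterlim_compose[OF b(2) this]
  have lim: "(\<lambda>t. measure_pmf.prob (PA_c 1 \<delta>' (m * t))
      {E. \<exists>v\<in>{1..m * t}. real (depth E v) > b * ln (real (m * t))}) \<longlonglongrightarrow> 0" .
  have "(\<lambda>t. measure_pmf.prob (PA_c 1 \<delta>' (m * t))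
      {E. real (diam {1..t} (merge m E)) \<le> 4 * b * ln (real t)}) \<longlonglongrightarrow> 1"
  proof (rule whp[OF lim], intro eventually_sequentiallyI[of "max 2 m"] ballI impI CollectI)
    fix t E assume t: "max 2 m \<le> t" and E: "E \<in> set_pmf (PA_c 1 \<delta>' (m * t))"
      and small: "E \<notin> {E. \<exists>v\<in>{1..m * t}. real (depth E v) > b * ln (real (m * t))}"
    have mt: "2 \<le> m * t" using m(1) t by (metis max.boundedE mult_le_mono nat_mult_1)
    have "\<exists>n. real n \<le> b * ln (real (m * t)) \<and> (u, block m 1) \<in> adj (merge m E) ^^ n"
      if u: "u \<in> {1..t}" for u
    proof -
      define v where "v = (u - 1) * m + 1"
      have v: "v \<in> {1..m * t}" "block m v = u" using block_first[OF m(1) u] by (auto simp: v_def)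
      have "(block m v, block m 1) \<in> adj (merge m E) ^^ depth E v"
        unfolding merge_def
        by (rule adj_image_relpow[where f = "block m"]) (rule PA_c_path_to_1[OF _ \<delta>' mt E v(1)], simp)
      moreover have "real (depth E v) \<le> b * ln (real (m * t))" using small v(1) by force
      ultimately show ?thesis using v(2) by blast
    qed
    then have "real (diam {1..t} (merge m E)) \<le> 2 * (b * ln (real (m * t)))"
      using t by (intro diam_le_center) auto
    also have "\<dots> \<le> 2 * (b * (2 * ln (real t)))"
      using b(1) ln_mult_le[OF m(1)] t by (intro mult_left_mono) auto
    finally show "real (diam {1..t} (merge m E)) \<le> 4 * b * ln (real t)" by simp
  qed
  then have "(\<lambda>t. measure_pmf.prob (PA_b m \<delta> t) {G. real (diam {1..t} G) \<le> 4 * b * ln (real t)}) \<longlonglongrightarrow> 1"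
    by (simp add: PA_b_def PA1_b_eq_PA_c \<delta>'_def vimage_def)
  with b(1) show ?thesis by (intro exI[of _ "4 * b"]) simp
qed

section \<open>Model (a)\<close>

lemma PA1_a_Suc:
  assumes "t \<ge> 1"
  shows "PA1_a \<delta> (Suc t) = do {
     E \<leftarrow> PA1_a \<delta> t; i \<leftarrow> attach_loop \<delta> t E; return_pmf (add_mset (Upair (Suc t) i) E)}"
  using assms by (cases t) auto

text \<open>Here \<open>\<delta>\<close> is the parameter of the unmerged process, that is, the
  original one divided by \<open>m\<close>, so the condition becomes
  \<open>\<delta> > - 1\<close>.\<close>

locale model_a =
  fixes m :: nat and \<delta> :: real
  assumes m: "m \<ge> 1" and \<delta>: "\<delta> > - 1"
begin

abbreviation M :: "nat \<Rightarrow> nat edges pmf" where "M \<equiv> PA1_a \<delta>"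

abbreviation Z :: "nat \<Rightarrow> real" where "Z t \<equiv> real t * (2 + \<delta>) + (1 + \<delta>)"

lemma graph: "t \<ge> 1 \<Longrightarrow> E \<in> set_pmf (M t) \<Longrightarrow> PA_graph 1 t E"
  using PA_graph_PA1_a \<delta> by blast

lemma set_attach_loop': "t \<ge> 1 \<Longrightarrow> E \<in> set_pmf (M t) \<Longrightarrow> set_pmf (attach_loop \<delta> t E) \<subseteq> {1..Suc t}"
  using set_attach_loop graph \<delta> by blast

lemma finite_attach_loop: "t \<ge> 1 \<Longrightarrow> E \<in> set_pmf (M t) \<Longrightarrow> finite (set_pmf (attach_loop \<delta> t E))"
  using set_attach_loop' finite_subset by blast

lemma finite_M: "t \<ge> 1 \<Longrightarrow> finite (set_pmf (M t))"
proof (induction t rule: dec_induct)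
  case (step t)
  then show ?case using finite_attach_loop by (auto simp: PA1_a_Suc)
qed simp

lemma Z_ge: "real t * (2 + \<delta>) \<le> Z t"
  using \<delta> by simp

lemma Z_pos: "Z t > 0"
  using \<delta> by (intro add_nonneg_pos[OF mult_nonneg_nonneg]) auto

lemma M_SucE:
  assumes "t \<ge> 1" "E \<in> set_pmf (M (Suc t))"
  obtains F i where "F \<in> set_pmf (M t)" "i \<in> {1..Suc t}" "E = add_mset (Upair (Suc t) i) F"
  using assms set_attach_loop'[OF assms(1)] by (fastforce simp: PA1_a_Suc)

text \<open>A vertex starts with degree at most 2, attained by a loop, and each later edge adds at
  most 1.\<close>

lemma degree_le:
  assumes "t \<ge> 1" "E \<in> set_pmf (M t)" "v \<in> {1..t}"
  shows "vdegree E v + v \<le> t + 2"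
  using assms
proof (induction t arbitrary: E v rule: dec_induct)
  case (step t)
  then obtain F i where F: "F \<in> set_pmf (M t)" "i \<in> {1..Suc t}" "E = add_mset (Upair (Suc t) i) F"
    using M_SucE by metis
  show ?case
  proof (cases "v = Suc t")
    case True
    then have "vdegree F v = 0"
      using vdegree_outside[OF PA_graph_edges[OF graph[OF _ F(1)]]] step.hyps by simp
    then show ?thesis using True F by auto
  next
    case False
    then have "vdegree F v + v \<le> t + 2" using step.IH[OF F(1)] step.prems by simp
    then show ?thesis using False F by auto
  qed
qed auto

text \<open>Only the edge added together with \<open>v\<close> can lead from \<open>v\<close> to a
  smaller vertex; later edges reach \<open>v\<close> from larger ones. This provides the uniqueness
  in \<open>common_root\<close> for \<open>m = 1\<close>.\<close>

lemma lower_unique: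
  assumes "t \<ge> 1" "E \<in> set_pmf (M t)" "k \<in> lower E v" "l \<in> lower E v"
  shows "k = l"
  using assms
proof (induction t arbitrary: E rule: dec_induct)
  case base
  then show ?case by (auto simp: lower_def)
next
  case (step t)
  then obtain F i where F: "F \<in> set_pmf (M t)" "i \<in> {1..Suc t}" "E = add_mset (Upair (Suc t) i) F"
    using M_SucE by metis
  have "lower F (Suc t) = {}"
    using PA_graph_edges[OF graph[OF step.hyps(1) F(1)]] by (fastforce simp: lower_def)
  then show ?case
    using step.IH[OF F(1)] step.prems F(2) by (auto simp: F(3) lower_add_mset_top split: if_splits)
qed

lemma pmf_loop:
  assumes "t \<ge> 1" "E \<in> set_pmf (M t)"
  shows "pmf (attach_loop \<delta> t E) (Suc t) = (1 + \<delta>) / Z t"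
    and "i \<in> {1..t} \<Longrightarrow> pmf (attach_loop \<delta> t E) i = (real (vdegree E i) + \<delta>) / Z t"
  by (simp_all add: pmf_attach_loop[OF graph[OF assms] \<delta>])

section \<open>Growth of the potential for merged blocks\<close>

abbreviation bdepth :: "nat edges \<Rightarrow> nat \<Rightarrow> nat" where
  "bdepth E v \<equiv> depth (merge m E) (block m v)"

text \<open>
  A new edge from \<open>t + 1\<close> to \<open>i\<close> may turn the block of \<open>t + 1\<close> from a root into a vertex of depth at
  most \<open>bdepth E i + 1\<close>. This block has at most \<open>m\<close> older vertices, each of degree at most \<open>m + 1\<close>.
\<close>

definition growth_const :: real where "growth_const = 1 + 2 * real m * (real m + 1 + \<delta>) + 2 * (1 + \<delta>)"

lemma growth_const_ge: "2 + \<delta> \<le> growth_const"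
proof -
  define x where "x = 2 * real m * (real m + 1 + \<delta>)"
  have "0 \<le> x" unfolding x_def using \<delta> by (intro mult_nonneg_nonneg) auto
  then show ?thesis unfolding growth_const_def x_def[symmetric] using \<delta> by simp
qed

text \<open>At time \<open>t + 1\<close> every vertex of the block under construction is less than
  \<open>m\<close> steps old, and \<open>degree_le\<close> turns age into degree.\<close>

lemma degree_current_block:
  assumes "t \<ge> 1" "E \<in> set_pmf (M t)" "v \<in> {1..t}" "block m v = block m (Suc t)"
  shows "vdegree E v \<le> m + 1"
  using degree_le[OF assms(1-3)] block_eq_close[OF assms(4) m] assms(3) by simp

text \<open>Depths are taken in the merged graph but summed over unmerged vertices, because the
  attachment law sees unmerged degrees. In \<open>growth_const\<close> the 1 is the unit of degree
  gained by \<open>i\<close>, the product with \<open>2 * real m\<close> covers the older vertices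
  of the current block, and \<open>2 * (1 + \<delta>)\<close> covers the new vertex.\<close>

lemma weight_step:
  assumes t: "t \<ge> 1" and E: "E \<in> set_pmf (M t)" and i: "i \<in> {1..Suc t}"
  defines "E' \<equiv> add_mset (Upair (Suc t) i) E"
  shows "weight \<delta> (bdepth E') (Suc t) E' \<le> weight \<delta> (bdepth E) t E
    + (if i = Suc t then (2 + \<delta>) * 2 ^ bdepth E (Suc t) else growth_const * 2 ^ bdepth E i)"
proof -
  let ?b = "block m (Suc t)"
  note G = graph[OF t E]
  have F': "merge m E' = add_mset (Upair ?b (block m i)) (merge m E)"
    by (simp add: E'_def merge_add_mset del: One_nat_def)
  have le: "block m i \<le> ?b" using i by (intro block_mono) auto
  have low: "lower (merge m E') w = lower (merge m E) w \<union> (if w = ?b \<and> block m i < ?b then {block m i} else {})" for w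
    unfolding F' by (rule lower_add_mset_top[OF le])
  have old: "bdepth E' v = bdepth E v" if "block m v < ?b \<or> block m i = ?b" for v
    using that by (intro depth_cong) (auto simp: low)
  have deg: "vdegree E' v = vdegree E v + of_bool (v = i)" if "v \<in> {1..t}" for v
    using that by (auto simp: E'_def)
  have "vdegree E (Suc t) = 0" using vdegree_outside[OF PA_graph_edges[OF G]] by simp
  then have deg_new: "vdegree E' (Suc t) = 1 + of_bool (i = Suc t)" by (auto simp: E'_def)
  have W': "weight \<delta> (bdepth E') (Suc t) E' = (\<Sum>v=1..t. (real (vdegree E v) + of_bool (v = i) + \<delta>) * 2 ^ bdepth E' v)
      + (1 + of_bool (i = Suc t) + \<delta>) * 2 ^ bdepth E' (Suc t)"
    unfolding weight_def by (simp add: deg_new deg del: One_nat_def)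
  have pos: "0 \<le> 1 + \<delta>" "0 \<le> real m + 1 + \<delta>" using \<delta> by auto
  show ?thesis
  proof (cases "block m i = ?b")
    case True
    \<comment> \<open>An edge inside the current block becomes a loop after merging, so no depth
      changes and only degrees grow.\<close>
    have same: "bdepth E' v = bdepth E v" for v using old[of v] True by blast
    have new: "bdepth E (Suc t) = bdepth E i" by (simp only: True)
    have "weight \<delta> (bdepth E') (Suc t) E' = weight \<delta> (bdepth E) t E
      + (\<Sum>v=1..t. of_bool (v = i) * 2 ^ bdepth E v) + (1 + of_bool (i = Suc t) + \<delta>) * 2 ^ bdepth E i"
      unfolding W' unfolding same new weight_def sum.distrib[symmetric] by (simp add: algebra_simps del: One_nat_def)
    moreover have "(\<Sum>v=1..t. of_bool (v = i) * 2 ^ bdepth E v :: real) = (if i = Suc t then 0 else 2 ^ bdepth E i)"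
    proof -
      have "(\<Sum>v=1..t. of_bool (v = i) * 2 ^ bdepth E v :: real) = (\<Sum>v=1..t. if v = i then 2 ^ bdepth E i else 0)"
        by (intro sum.cong) auto
      then show ?thesis using i by auto
    qed
    moreover have "(2 + \<delta>) * 2 ^ bdepth E i \<le> growth_const * 2 ^ bdepth E i"
      by (intro mult_right_mono growth_const_ge) simp
    ultimately show ?thesis by (auto simp: algebra_simps)
  next
    case False
    then have less: "block m i < ?b" and it: "i \<in> {1..t}" using le i by (auto simp: le_Suc_eq)
    have "depth (merge m E') ?b \<le> Suc (bdepth E' i)" using less by (intro depth_le) (simp add: low)
    then have dnew: "(2::real) ^ depth (merge m E') ?b \<le> 2 * 2 ^ bdepth E i"
      using power_increasing[of "depth (merge m E') ?b" "Suc (bdepth E i)" "2::real"] old[of i] less by simp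
    \<comment> \<open>The terms on the right are the old weight, the unit of degree gained by the
      end point, and an allowance for vertices of the current block, whose depth can rise only if
      the block was a root.\<close>
    have "(real (vdegree E v) + of_bool (v = i) + \<delta>) * 2 ^ bdepth E' v
        \<le> (real (vdegree E v) + \<delta>) * 2 ^ bdepth E v + of_bool (v = i) * 2 ^ bdepth E i
          + of_bool (block m v = ?b) * ((real m + 1 + \<delta>) * (2 * 2 ^ bdepth E i))" if v: "v \<in> {1..t}" for v
    proof (cases "block m v = ?b")
      case True
      then have "v \<noteq> i" using less by auto
      have D: "1 \<le> real (vdegree E v)" using PA_graph_degree[OF G v] by simp
      have "real (vdegree E v) \<le> real m + 1" using degree_current_block[OF t E v True] by linarith
      then have "(real (vdegree E v) + \<delta>) * 2 ^ bdepth E' v \<le> (real m + 1 + \<delta>) * (2 * 2 ^ bdepth E i)"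
        using pos True dnew by (intro mult_mono) auto
      moreover have "0 \<le> (real (vdegree E v) + \<delta>) * 2 ^ bdepth E v" using D \<delta> by simp
      ultimately show ?thesis using \<open>v \<noteq> i\<close> True by simp
    next
      case False
      then have "block m v < ?b" using block_mono[of v "Suc t" m] v by (simp del: One_nat_def add: le_neq_implies_less)
      then show ?thesis using old[of v] False by (auto simp: algebra_simps)
    qed
    then have "(\<Sum>v=1..t. (real (vdegree E v) + of_bool (v = i) + \<delta>) * 2 ^ bdepth E' v)
        \<le> (\<Sum>v=1..t. (real (vdegree E v) + \<delta>) * 2 ^ bdepth E v + of_bool (v = i) * 2 ^ bdepth E i
          + of_bool (block m v = ?b) * ((real m + 1 + \<delta>) * (2 * 2 ^ bdepth E i)))"
      by (rule sum_mono)
    also have "\<dots> = weight \<delta> (bdepth E) t E + (\<Sum>v=1..t. of_bool (v = i) * 2 ^ bdepth E i)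
        + (\<Sum>v=1..t. of_bool (block m v = ?b)) * ((real m + 1 + \<delta>) * (2 * 2 ^ bdepth E i))"
      unfolding weight_def sum.distrib sum_distrib_right ..
    also have "(\<Sum>v=1..t. of_bool (v = i) * 2 ^ bdepth E i :: real) = 2 ^ bdepth E i"
    proof -
      have "(\<Sum>v=1..t. of_bool (v = i) * 2 ^ bdepth E i :: real) = (\<Sum>v=1..t. if v = i then 2 ^ bdepth E i else 0)"
        by (intro sum.cong) auto
      then show ?thesis using it by simp
    qed
    also have "(\<Sum>v=1..t. of_bool (block m v = ?b) :: real) = real (card {v \<in> {1..t}. block m v = ?b})"
      by (simp add: sum_of_bool_eq Int_def)
    finally have "(\<Sum>v=1..t. (real (vdegree E v) + of_bool (v = i) + \<delta>) * 2 ^ bdepth E' v)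
        \<le> weight \<delta> (bdepth E) t E + 2 ^ bdepth E i
          + real (card {v \<in> {1..t}. block m v = ?b}) * ((real m + 1 + \<delta>) * (2 * 2 ^ bdepth E i))" .
    moreover have "card {v \<in> {1..t}. block m v = ?b} \<le> card {v \<in> {1..Suc t}. block m v = ?b}"
      by (intro card_mono) auto
    then have "card {v \<in> {1..t}. block m v = ?b} \<le> m" using card_block_le[OF m, of "Suc t"] by linarith
    then have "real (card {v \<in> {1..t}. block m v = ?b}) * ((real m + 1 + \<delta>) * (2 * 2 ^ bdepth E i))
        \<le> real m * ((real m + 1 + \<delta>) * (2 * 2 ^ bdepth E i))"
      using pos by (intro mult_right_mono) auto
    moreover have "(1 + \<delta>) * 2 ^ bdepth E' (Suc t) \<le> (1 + \<delta>) * (2 * 2 ^ bdepth E i)"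
      using dnew pos by (intro mult_left_mono)
    moreover have "i \<noteq> Suc t" using it by auto
    ultimately show ?thesis unfolding W' by (simp add: growth_const_def algebra_simps)
  qed
qed

text \<open>The vertex \<open>t + 1\<close> is not yet in \<open>E\<close>, so
  \<open>weight_ge\<close> does not cover it directly. Its block either has depth 0 or already
  contains an older vertex, which has the same \<open>bdepth\<close>.\<close>

lemma weight_ge_new:
  assumes t: "t \<ge> 1" and E: "E \<in> set_pmf (M t)"
  shows "(1 + \<delta>) * 2 ^ bdepth E (Suc t) \<le> weight \<delta> (bdepth E) t E"
proof -
  note G = graph[OF t E]
  have "\<exists>v\<in>{1..t}. bdepth E (Suc t) \<le> bdepth E v"
  proof (cases "lower (merge m E) (block m (Suc t)) = {}")
    case True
    then have "bdepth E (Suc t) = 0" by (simp add: depth_eq_0_iff)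
    then show ?thesis using t by (intro bexI[of _ 1]) auto
  next
    case False
    then obtain k where "Upair (block m (Suc t)) k \<in># merge m E" by (auto simp: lower_def)
    from merge_edges[OF PA_graph_edges[OF G] this]
    obtain v where "v \<in> {1..t}" "block m (Suc t) = block m v" by auto
    then show ?thesis by (intro bexI[of _ v]) auto
  qed
  then obtain v where v: "v \<in> {1..t}" "bdepth E (Suc t) \<le> bdepth E v" by auto
  have "(1 + \<delta>) * 2 ^ bdepth E (Suc t) \<le> (1 + \<delta>) * 2 ^ bdepth E v"
    using v(2) \<delta> by (intro mult_left_mono power_increasing) auto
  also have "\<dots> \<le> weight \<delta> (bdepth E) t E" using weight_ge[OF G _ v(1), of \<delta>] \<delta> by simp
  finally show ?thesis .
qed

text \<open>Averages \<open>weight_step\<close>. A loop has probability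
  \<open>(1 + \<delta>) / Z t\<close>, so by \<open>weight_ge_new\<close> it contributes at most
  \<open>(2 + \<delta>) / Z t\<close> times the potential; the other end points contribute
  \<open>growth_const / Z t\<close> times it.\<close>

lemma growth:
  assumes t: "t \<ge> 1"
  shows "measure_pmf.expectation (M (Suc t)) (\<lambda>E. weight \<delta> (bdepth E) (Suc t) E)
    \<le> (1 + (growth_const + 2 + \<delta>) / (2 + \<delta>) / real t) * measure_pmf.expectation (M t) (\<lambda>E. weight \<delta> (bdepth E) t E)"
  unfolding PA1_a_Suc[OF t]
proof (rule expectation_bind_le[OF finite_M[OF t]])
  fix E assume E: "E \<in> set_pmf (M t)"
  let ?p = "attach_loop \<delta> t E" and ?W = "weight \<delta> (bdepth E) t E"
  note fin = finite_attach_loop[OF t E]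
  note p = pmf_loop[OF t E]
  show "finite (set_pmf (?p \<bind> (\<lambda>i. return_pmf (add_mset (Upair (Suc t) i) E))))" using fin by simp
  have W: "0 \<le> ?W" by (rule order_trans[OF _ weight_ge_new[OF t E]]) (use \<delta> in simp)
  let ?f = "\<lambda>i. ?W + (if i = Suc t then (2 + \<delta>) * 2 ^ bdepth E (Suc t) else growth_const * 2 ^ bdepth E i)"
  have "measure_pmf.expectation (?p \<bind> (\<lambda>i. return_pmf (add_mset (Upair (Suc t) i) E)))
      (\<lambda>E. weight \<delta> (bdepth E) (Suc t) E) =
    measure_pmf.expectation ?p (\<lambda>i. weight \<delta> (bdepth (add_mset (Upair (Suc t) i) E)) (Suc t) (add_mset (Upair (Suc t) i) E))"
    using fin by (simp add: expectation_bind_pmf)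
  also have "\<dots> \<le> measure_pmf.expectation ?p ?f"
    by (rule expectation_pmf_mono[OF fin]) (use set_attach_loop'[OF t E] weight_step[OF t E] in blast)
  also have "\<dots> = ?W + measure_pmf.expectation ?p (\<lambda>i. if i = Suc t then (2 + \<delta>) * 2 ^ bdepth E (Suc t) else growth_const * 2 ^ bdepth E i)"
    by (simp add: integrable_measure_pmf_finite[OF fin])
  also have "measure_pmf.expectation ?p (\<lambda>i. if i = Suc t then (2 + \<delta>) * 2 ^ bdepth E (Suc t) else growth_const * 2 ^ bdepth E i)
      = (\<Sum>i=1..Suc t. (if i = Suc t then (2 + \<delta>) * 2 ^ bdepth E (Suc t) else growth_const * 2 ^ bdepth E i) * pmf ?p i)"
    using set_attach_loop'[OF t E] by (intro integral_measure_pmf_real) auto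
  also have "\<dots> = (\<Sum>i=1..t. growth_const * 2 ^ bdepth E i * ((real (vdegree E i) + \<delta>) / Z t))
      + (2 + \<delta>) * 2 ^ bdepth E (Suc t) * ((1 + \<delta>) / Z t)"
    using p by (simp del: One_nat_def)
  also have "(\<Sum>i=1..t. growth_const * 2 ^ bdepth E i * ((real (vdegree E i) + \<delta>) / Z t)) = growth_const * ?W / Z t"
    unfolding weight_def sum_distrib_left sum_divide_distrib by (intro sum.cong) auto
  also have "(2 + \<delta>) * 2 ^ bdepth E (Suc t) * ((1 + \<delta>) / Z t) = (2 + \<delta>) * ((1 + \<delta>) * 2 ^ bdepth E (Suc t)) / Z t"
    by simp
  also have "\<dots> \<le> (2 + \<delta>) * ?W / Z t"
    using weight_ge_new[OF t E] Z_pos[of t] \<delta> by (intro divide_right_mono mult_left_mono) auto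
  also have "?W + (growth_const * ?W / Z t + (2 + \<delta>) * ?W / Z t) = ?W + (growth_const + 2 + \<delta>) * ?W / Z t"
    by (simp add: add_divide_distrib[symmetric] algebra_simps)
  also have "\<dots> \<le> ?W + (growth_const + 2 + \<delta>) * ?W / (real t * (2 + \<delta>))"
  proof -
    have "0 \<le> growth_const + 2 + \<delta>" using \<delta> growth_const_ge by linarith
    then show ?thesis
      using W Z_pos[of t] Z_ge[of t] \<delta> t by (intro add_left_mono divide_left_mono) (auto intro!: mult_nonneg_nonneg mult_pos_pos)
  qed
  also have "\<dots> = (1 + (growth_const + 2 + \<delta>) / (2 + \<delta>) / real t) * ?W" by (simp add: algebra_simps)
  finally show "measure_pmf.expectation (?p \<bind> (\<lambda>i. return_pmf (add_mset (Upair (Suc t) i) E)))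
      (\<lambda>E. weight \<delta> (bdepth E) (Suc t) E) \<le> (1 + (growth_const + 2 + \<delta>) / (2 + \<delta>) / real t) * ?W" by simp
qed

lemma bdepth_tail:
  obtains b where "b > 0" "(\<lambda>t. measure_pmf.prob (M (m * t))
    {E. \<exists>v\<in>{1..m * t}. real (bdepth E v) > b * ln (real (m * t))}) \<longlonglongrightarrow> 0"
proof -
  have dom: "(1 + \<delta>) * 2 ^ bdepth E v \<le> weight \<delta> (bdepth E) t E"
    if "t \<ge> 1" "E \<in> set_pmf (M t)" "v \<in> {1..t}" for t E v
    using weight_ge[OF graph[OF that(1,2)] _ that(3), of \<delta>] \<delta> by simp
  have pos: "0 < 1 + \<delta>" using \<delta> by simp
  obtain b where b: "b > 0" "(\<lambda>t. measure_pmf.prob (M t)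
      {E. \<exists>v\<in>{1..t}. real (bdepth E v) > b * ln (real t)}) \<longlonglongrightarrow> 0"
    by (rule depth_tail[where M = M and W = "\<lambda>t E. weight \<delta> (bdepth E) t E" and d = bdepth
        and \<alpha> = "1 + \<delta>" and ?t0.0 = 1, OF finite_M dom growth pos order_refl])
  have "filterlim (\<lambda>t. m * t) sequentially sequentially"
    using m by (intro filterlim_subseq strict_monoI) auto
  from filterlim_compose[OF b(2) this] b(1) show thesis using that by blast
qed

section \<open>Probability that a block remains a root\<close>

definition loop_const :: real where "loop_const = real m * (real m + 1 + \<delta>) / (2 + \<delta>)"

lemma loop_const_nonneg: "0 \<le> loop_const"
  using \<delta> by (auto simp: loop_const_def)

text \<open>In graphs of the process a block without vertices also belongs here, so membership can
  only be lost as edges arrive.\<close>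

definition root :: "nat \<Rightarrow> nat edges set" where
  "root j = {E. lower (merge m E) j = {}}"

lemma root_antimono:
  assumes "t \<ge> 1"
  shows "measure_pmf.prob (M (Suc t)) (root j) \<le> measure_pmf.prob (M t) (root j)"
proof -
  have "measure_pmf.prob (M (Suc t)) (root j) \<le> 1 * measure_pmf.prob (M t) (root j)"
    unfolding PA1_a_Suc[OF assms]
  proof (rule prob_bind_le[OF finite_M[OF assms]])
    fix E assume E: "E \<in> set_pmf (M t)"
    let ?K = "attach_loop \<delta> t E \<bind> (\<lambda>i. return_pmf (add_mset (Upair (Suc t) i) E))"
    show "finite (set_pmf ?K)" using finite_attach_loop[OF assms E] by simp
    show "measure_pmf.prob ?K (root j) \<le> 1 * indicator (root j) E"
    proof (cases "E \<in> root j")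
      case False
      then have "set_pmf ?K \<inter> root j = {}"
        using lower_mono[OF merge_mono[of E "add_mset _ E" m]] by (auto simp: root_def)
      then have "measure_pmf.prob ?K (root j) = 0" by (simp only: measure_pmf_zero_iff)
      then show ?thesis by simp
    qed auto
  qed
  then show ?thesis by simp
qed

text \<open>Block \<open>j\<close> stays a root only if the edge of \<open>t + 1\<close> ends in
  \<open>j\<close> itself. That leaves at most \<open>m\<close> end points, each of probability at
  most \<open>(m + 1 + \<delta>) / Z t\<close>.\<close>

lemma root_step:
  assumes t: "t \<ge> 1" and j: "block m (Suc t) = j"
  shows "measure_pmf.prob (M (Suc t)) (root j) \<le> loop_const / real t * measure_pmf.prob (M t) (root j)"
  unfolding PA1_a_Suc[OF t]
proof (rule prob_bind_le[OF finite_M[OF t]])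
  fix E assume E: "E \<in> set_pmf (M t)"
  let ?p = "attach_loop \<delta> t E"
  let ?K = "?p \<bind> (\<lambda>i. return_pmf (add_mset (Upair (Suc t) i) E))"
  show "finite (set_pmf ?K)" using finite_attach_loop[OF t E] by simp
  show "measure_pmf.prob ?K (root j) \<le> loop_const / real t * indicator (root j) E"
  proof (cases "E \<in> root j")
    case False
    then have "set_pmf ?K \<inter> root j = {}"
      using lower_mono[OF merge_mono[of E "add_mset _ E" m]] by (auto simp: root_def)
    then have "measure_pmf.prob ?K (root j) = 0" by (simp only: measure_pmf_zero_iff)
    then show ?thesis using False by simp
  next
    case True
    let ?B = "{v \<in> {1..Suc t}. block m v = j}"
    have K: "?K = map_pmf (\<lambda>i. add_mset (Upair (Suc t) i) E) ?p" by (simp add: map_pmf_def)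
    have "measure_pmf.prob ?K (root j) = measure_pmf.prob ?p {i. add_mset (Upair (Suc t) i) E \<in> root j}"
      unfolding K by (simp add: vimage_def)
    also have "\<dots> \<le> measure_pmf.prob ?p ?B"
    proof (rule measure_pmf.finite_measure_mono_AE, unfold AE_measure_pmf_iff, intro ballI impI)
      fix i assume "i \<in> set_pmf ?p" and r: "i \<in> {i. add_mset (Upair (Suc t) i) E \<in> root j}"
      then have i: "i \<in> {1..Suc t}" using set_attach_loop'[OF t E] by blast
      then have "block m i \<le> j" unfolding j[symmetric] by (intro block_mono) auto
      moreover have "lower (add_mset (Upair j (block m i)) (merge m E)) j = {}"
        using r by (simp add: root_def merge_add_mset j[symmetric] del: One_nat_def)
      ultimately show "i \<in> ?B" using i lower_add_mset_top[of "block m i" j "merge m E" j]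
        by (auto split: if_splits)
    qed simp
    also have "\<dots> = (\<Sum>i\<in>?B. pmf ?p i)" by (rule measure_measure_pmf_finite) simp
    also have "\<dots> \<le> real (card ?B) * ((real m + 1 + \<delta>) / Z t)"
    proof (rule sum_bounded_above)
      fix i assume i: "i \<in> ?B"
      show "pmf ?p i \<le> (real m + 1 + \<delta>) / Z t"
      proof (cases "i = Suc t")
        case True
        then show ?thesis using pmf_loop(1)[OF t E] Z_pos[of t] by (auto intro!: divide_right_mono)
      next
        case False
        then have it: "i \<in> {1..t}" using i by auto
        have "real (vdegree E i) \<le> real m + 1"
          using degree_current_block[OF t E it] i j by simp
        then show ?thesis using pmf_loop(2)[OF t E it] Z_pos[of t] by (auto intro!: divide_right_mono)
      qed
    qed
    also have "\<dots> \<le> real m * ((real m + 1 + \<delta>) / Z t)"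
      using card_block_le[OF m, of "Suc t"] \<delta> Z_pos[of t] unfolding j
      by (intro mult_right_mono divide_nonneg_nonneg) auto
    also have "\<dots> \<le> real m * ((real m + 1 + \<delta>) / (real t * (2 + \<delta>)))"
      using Z_ge[of t] Z_pos[of t] \<delta> t by (intro mult_left_mono divide_left_mono) auto
    also have "\<dots> = loop_const / real t" by (simp add: loop_const_def)
    finally show ?thesis using True by simp
  qed
qed

text \<open>With \<open>s\<close> the last vertex of block \<open>j - 1\<close>, block
  \<open>j\<close> contains \<open>s + 1\<close> and \<open>s + 2\<close> because
  \<open>m \<ge> 2\<close>. Applying \<open>root_step\<close> to both yields two factors of order
  \<open>1 / j\<close>, which makes the bound summable over \<open>j\<close>.\<close>

lemma prob_root_le:
  assumes "m \<ge> 2" "j \<ge> 2" "j \<le> t"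
  shows "measure_pmf.prob (M (m * t)) (root j) \<le> loop_const\<^sup>2 * (1 / real (j - 1) ^ 2)"
proof -
  define s where "s = (j - 1) * m"
  have s: "j - 1 \<le> s" "s \<ge> 1" using assms by (auto simp: s_def)
  have "(1 + (j - 1) * m) div m = j - 1" using assms by (subst div_mult_self1) auto
  then have b: "block m (Suc s) = j" "block m (Suc (Suc s)) = j" using assms by (auto simp: s_def)
  have "(j - 1) * m + m \<le> m * t" using assms mult_le_mono1[of j t m] by (cases j) (auto simp: mult.commute)
  then have "Suc (Suc s) \<le> m * t" using assms by (simp add: s_def)
  then have "measure_pmf.prob (M (m * t)) (root j) \<le> measure_pmf.prob (M (Suc (Suc s))) (root j)"
  proof (induction rule: dec_induct)
    case (step n)
    then show ?case using root_antimono[of n j] by simp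
  qed simp
  also have "\<dots> \<le> loop_const / real (Suc s) * measure_pmf.prob (M (Suc s)) (root j)"
    using root_step[of "Suc s" j] b by simp
  also have "\<dots> \<le> loop_const / real (Suc s) * (loop_const / real s * measure_pmf.prob (M s) (root j))"
    using root_step[OF s(2) b(1)] loop_const_nonneg by (intro mult_left_mono) auto
  also have "\<dots> \<le> loop_const / real (Suc s) * (loop_const / real s * 1)"
    using loop_const_nonneg by (intro mult_left_mono) auto
  also have "\<dots> \<le> loop_const / real (j - 1) * (loop_const / real (j - 1))"
  proof -
    have "loop_const / real x \<le> loop_const / real (j - 1)" if "j - 1 \<le> x" for x
      by (intro divide_left_mono of_nat_mono) (use that assms loop_const_nonneg in auto)
    then show ?thesis using s loop_const_nonneg by (intro mult_mono) (auto simp del: of_nat_Suc)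
  qed
  finally show ?thesis by (simp add: power2_eq_square)
qed

text \<open>Union bound and the tail of the convergent series of \<open>1 / n ^ 2\<close>;
  \<open>K\<close> is uniform in \<open>t\<close>.\<close>

lemma prob_late_root:
  assumes "m \<ge> 2" "\<epsilon> > 0"
  obtains K where "\<And>t. measure_pmf.prob (M (m * t)) (\<Union>j\<in>{K<..t}. root j) < \<epsilon>"
proof -
  have "summable (\<lambda>n. loop_const\<^sup>2 * (1 / real n ^ 2))"
    using inverse_power_summable[of 2, where 'a = real] by (intro summable_mult) (simp add: inverse_eq_divide)
  then obtain N where N: "\<And>k n. k \<ge> N \<Longrightarrow> norm (\<Sum>i=k..<n. loop_const\<^sup>2 * (1 / real i ^ 2)) < \<epsilon>"
    using assms(2) unfolding summable_Cauchy by meson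
  \<comment> \<open>The maximum with 1 ensures \<open>j \<ge> 2\<close> for every
    \<open>j > K\<close>, as \<open>prob_root_le\<close> requires.\<close>
  define K where "K = max N 1"
  have "measure_pmf.prob (M (m * t)) (\<Union>j\<in>{K<..t}. root j) < \<epsilon>" for t
  proof -
    have "measure_pmf.prob (M (m * t)) (\<Union>j\<in>{K<..t}. root j) \<le> (\<Sum>j\<in>{K<..t}. measure_pmf.prob (M (m * t)) (root j))"
      by (rule measure_pmf.finite_measure_subadditive_finite) auto
    also have "\<dots> \<le> (\<Sum>j\<in>{K<..t}. loop_const\<^sup>2 * (1 / real (j - 1) ^ 2))"
      using prob_root_le[OF assms(1)] by (intro sum_mono) (auto simp: K_def)
    also have "\<dots> = (\<Sum>i=K..<t. loop_const\<^sup>2 * (1 / real i ^ 2))"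
      by (rule sum.reindex_bij_witness[of _ Suc "\<lambda>j. j - 1"]) auto
    also have "\<dots> < \<epsilon>" using N[of K t] by (simp add: K_def)
    finally show ?thesis .
  qed
  then show thesis by (rule that)
qed

section \<open>Stabilisation of connections between early blocks\<close>

definition early :: "nat \<Rightarrow> nat edges \<Rightarrow> nat edges" where
  "early s E = {#e \<in># E. set_uprod e \<subseteq> {1..s}#}"

text \<open>Edges added after time \<open>s\<close> have an end point above \<open>s\<close>, so
  \<open>early s\<close> recovers the graph at time \<open>s\<close>. The laws \<open>M t\<close>
  are given separately for each \<open>t\<close>; this puts two times on one probability
  space.\<close>

lemma early_law:
  assumes "1 \<le> s" "s \<le> t"
  shows "map_pmf (early s) (M t) = M s"
  using assms(2)
proof (induction t rule: dec_induct)
  case base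
  have "early s E = E" if "E \<in> set_pmf (M s)" for E
    using PA_graph_edges[OF graph[OF assms(1) that]] by (simp add: early_def filter_mset_eq_conv)
  then have "map_pmf (early s) (M s) = map_pmf (\<lambda>E. E) (M s)" by (intro map_pmf_cong) auto
  then show ?case by simp
next
  case (step t)
  have "early s (add_mset (Upair (Suc t) i) E) = early s E" for i E
    using step.hyps by (simp add: early_def)
  then show ?case
    using step.IH step.hyps assms(1)
    by (simp add: PA1_a_Suc map_bind_pmf map_pmf_def bind_assoc_pmf bind_return_pmf)
qed

text \<open>Only the end points are restricted to \<open>{1..K}\<close>; a connecting walk may leave
  this set.\<close>

definition conn :: "nat \<Rightarrow> nat edges \<Rightarrow> (nat \<times> nat) set" where
  "conn K E = {(i, j) \<in> {1..K} \<times> {1..K}. (i, j) \<in> (adj (merge m E))\<^sup>*}"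

lemma finite_conn: "finite (conn K E)"
  unfolding conn_def by (rule finite_subset[of _ "{1..K} \<times> {1..K}"]) auto

lemma conn_early: "conn K (early s E) \<subseteq> conn K E"
proof -
  have "adj (merge m (early s E)) \<subseteq> adj (merge m E)"
    by (intro adj_mono merge_mono) (simp add: early_def)
  from rtrancl_mono[OF this] show ?thesis by (auto simp: conn_def)
qed

text \<open>
  The expected number of connected pairs of blocks in \<open>{1..K}\<close> increases with time and is bounded,
  so after some time new connections between these blocks are unlikely to appear.
\<close>

lemma conn_stabilises:
  assumes "\<epsilon> > 0"
  obtains S where "\<And>t. t \<ge> S \<Longrightarrow> measure_pmf.prob (M t) {E. conn K E \<noteq> conn K (early S E)} < \<epsilon>"
proof -
  define a where "a t = measure_pmf.expectation (M t) (\<lambda>E. real (card (conn K E)))" for t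
  have fin: "finite (set_pmf (M (Suc t)))" for t by (rule finite_M) simp
  \<comment> \<open>The earlier expectation is moved to the law at the later time, where the two
    connection relations are nested. Times carry a \<open>Suc\<close> because
    \<open>finite_M\<close> and \<open>early_law\<close> start at time 1.\<close>
  have a_early: "a (Suc s) = measure_pmf.expectation (M (Suc t)) (\<lambda>E. real (card (conn K (early (Suc s) E))))"
    if "s \<le> t" for s t
    unfolding a_def by (subst early_law[of "Suc s" "Suc t", symmetric]) (use that in auto)
  have card_le: "card (conn K (early s E)) \<le> card (conn K E)" for s E
    by (intro card_mono finite_conn conn_early)
  have "incseq (\<lambda>t. a (Suc t))"
  proof (rule monoI)
    fix s t :: nat assume st: "s \<le> t"
    show "a (Suc s) \<le> a (Suc t)" unfolding a_early[OF st]
      unfolding a_def by (intro expectation_pmf_mono fin) (simp add: card_le)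
  qed
  moreover have "a (Suc t) \<le> real (card ({1..K} \<times> {1..K}))" for t
  proof -
    have "a (Suc t) \<le> measure_pmf.expectation (M (Suc t)) (\<lambda>E. real (card ({1..K} \<times> {1..K})))"
      unfolding a_def by (intro expectation_pmf_mono fin of_nat_mono card_mono) (auto simp: conn_def)
    then show ?thesis by simp
  qed
  ultimately obtain L where "(\<lambda>t. a (Suc t)) \<longlonglongrightarrow> L" using incseq_convergent by metis
  then have "Cauchy (\<lambda>t. a (Suc t))" by (intro convergent_Cauchy convergentI)
  then obtain N where N: "\<And>s t. s \<ge> N \<Longrightarrow> t \<ge> N \<Longrightarrow> norm (a (Suc s) - a (Suc t)) < \<epsilon>"
    using assms unfolding Cauchy_iff by meson
  have "measure_pmf.prob (M t) {E. conn K E \<noteq> conn K (early (Suc N) E)} < \<epsilon>" if "t \<ge> Suc N" for t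
  proof -
    obtain r where t: "t = Suc r" "r \<ge> N" using \<open>t \<ge> Suc N\<close> by (cases t) auto
    have "measure_pmf.prob (M t) {E. conn K E \<noteq> conn K (early (Suc N) E)}
      = measure_pmf.expectation (M t) (indicator {E. conn K E \<noteq> conn K (early (Suc N) E)})" by simp
    \<comment> \<open>Nested finite relations that differ have cardinalities differing by at least
      1, so the indicator is at most the difference of the counts.\<close>
    also have "\<dots> \<le> measure_pmf.expectation (M t) (\<lambda>E. real (card (conn K E)) - real (card (conn K (early (Suc N) E))))"
      unfolding t
    proof (rule expectation_pmf_mono[OF fin])
      fix E
      have "card (conn K (early (Suc N) E)) < card (conn K E)" if "conn K E \<noteq> conn K (early (Suc N) E)"
        using that conn_early[of K "Suc N" E] by (intro psubset_card_mono finite_conn) auto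
      then show "indicator {E. conn K E \<noteq> conn K (early (Suc N) E)} E
        \<le> real (card (conn K E)) - real (card (conn K (early (Suc N) E)))"
        by (cases "conn K E = conn K (early (Suc N) E)") (auto simp: indicator_def)
    qed
    also have "\<dots> = a (Suc r) - a (Suc N)"
      unfolding a_early[OF t(2)] unfolding a_def t(1) by (simp add: integrable_measure_pmf_finite[OF fin])
    also have "\<dots> < \<epsilon>" using N[of r N] t(2) by simp
    finally show ?thesis .
  qed
  then show thesis by (rule that)
qed

text \<open>The connection exists within the first \<open>S\<close> unmerged vertices, hence among
  at most \<open>S\<close> blocks. There are at most \<open>S * S\<close> adjacent pairs, and a walk
  no longer than their number suffices; the bound is uniform in time.\<close>

lemma early_dist:
  assumes "(i, j) \<in> conn K (early S E)"
  shows "\<exists>n \<le> S * S. (i, j) \<in> adj (merge m E) ^^ n"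
proof -
  let ?R = "adj (merge m (early S E))"
  have "\<forall>e\<in>#early S E. set_uprod e \<subseteq> {1..S}" by (auto simp: early_def)
  from merge_edges[OF this] have edges: "set_uprod e \<subseteq> block m ` {1..S}" if "e \<in># merge m (early S E)" for e
    using that by blast
  have R: "?R \<subseteq> (block m ` {1..S}) \<times> (block m ` {1..S})"
    using edges by (fastforce simp: adj_def)
  then have fin: "finite ?R" by (rule finite_subset) simp
  have "card ?R \<le> card ((block m ` {1..S}) \<times> (block m ` {1..S}))" using R by (intro card_mono) auto
  also have "\<dots> \<le> S * S"
    using card_image_le[of "{1..S}" "block m"] by (simp add: card_cartesian_product mult_le_mono)
  finally have card: "card ?R \<le> S * S" .
  have "(i, j) \<in> ?R\<^sup>*" using assms by (simp add: conn_def)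
  then obtain n where "n \<le> card ?R" "(i, j) \<in> ?R ^^ n" by (auto simp: rtrancl_finite_eq_relpow[OF fin])
  moreover have "?R \<subseteq> adj (merge m E)" by (intro adj_mono merge_mono) (simp add: early_def)
  ultimately show ?thesis using card relpow_subset[of ?R] by (meson order_trans subsetD)
qed

section \<open>Diameter in model (a)\<close>

lemma merged_edges_range:
  assumes "t \<ge> 1" "E \<in> set_pmf (M (m * t))"
  shows "\<forall>e\<in>#merge m E. set_uprod e \<subseteq> {1..t}"
proof
  fix e assume "e \<in># merge m E"
  moreover have "1 \<le> m * t" using assms(1) m by simp
  ultimately have "set_uprod e \<subseteq> block m ` {1..m * t}"
    using merge_edges[OF PA_graph_edges[OF graph[OF _ assms(2)]]] by blast
  also have "\<dots> \<subseteq> {1..t}"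
  proof
    fix x assume "x \<in> block m ` {1..m * t}"
    then obtain v where v: "v \<in> {1..m * t}" "x = block m v" by auto
    then have "v - 1 < t * m" by (auto simp: mult.commute)
    then have "(v - 1) div m < t" using less_mult_imp_div_less by blast
    then show "x \<in> {1..t}" using v(2) by simp
  qed
  finally show "set_uprod e \<subseteq> {1..t}" .
qed

lemma small_depths:
  assumes "b > 0" "t \<ge> m"
    "E \<notin> {E. \<exists>v\<in>{1..m * t}. real (bdepth E v) > b * ln (real (m * t))}" "u \<in> {1..t}"
  shows "real (depth (merge m E) u) \<le> 2 * b * ln (real t)"
proof -
  have "real (depth (merge m E) u) \<le> b * ln (real (m * t))"
    using assms(3) block_first[OF m assms(4)] by (metis (mono_tags, lifting) mem_Collect_eq not_less)
  also have "\<dots> \<le> b * (2 * ln (real t))"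
    using assms(1) ln_mult_le[OF m assms(2)] by (intro mult_left_mono) auto
  finally show ?thesis by simp
qed

text \<open>Merging changes nothing here, and \<open>lower_unique\<close> makes
  \<open>common_root\<close> applicable: connected vertices are joined through their common root, at
  the cost of two depths of at most \<open>2 * b * ln t\<close> each.\<close>

lemma diam_m1:
  assumes "m = 1"
  shows "\<exists>c>0. (\<lambda>t. measure_pmf.prob (M (m * t)) {E. real (diam {1..t} (merge m E)) \<le> c * ln (real t)}) \<longlonglongrightarrow> 1"
proof -
  obtain b where b: "b > 0" "(\<lambda>t. measure_pmf.prob (M (m * t))
      {E. \<exists>v\<in>{1..m * t}. real (bdepth E v) > b * ln (real (m * t))}) \<longlonglongrightarrow> 0" by (rule bdepth_tail)
  have "(\<lambda>t. measure_pmf.prob (M (m * t)) {E. real (diam {1..t} (merge m E)) \<le> 4 * b * ln (real t)}) \<longlonglongrightarrow> 1"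
  proof (rule whp[OF b(2)], intro eventually_sequentiallyI[of 1] ballI impI CollectI)
    fix t E assume t: "1 \<le> t" and E: "E \<in> set_pmf (M (m * t))"
      and small: "E \<notin> {E. \<exists>v\<in>{1..m * t}. real (bdepth E v) > b * ln (real (m * t))}"
    have E': "E \<in> set_pmf (M t)" using E assms by simp
    \<comment> \<open>The block map for \<open>m = 1\<close> fixes positive vertices but sends 0 to
      1, hence the appeal to the vertex range.\<close>
    have "map_uprod (block 1) e = e" if "e \<in># E" for e
    proof -
      have "set_uprod e \<subseteq> {1..t}" using PA_graph_edges[OF graph[OF t E']] that by blast
      then show ?thesis by (cases e) auto
    qed
    then have "merge m E = E" unfolding merge_def assms by (simp cong: image_mset_cong)
    then have uniq: "k = l" if "k \<in> lower (merge m E) v" "l \<in> lower (merge m E) v" for v k l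
      using lower_unique[OF t E'] that by simp
    show "real (diam {1..t} (merge m E)) \<le> 4 * b * ln (real t)"
    proof (rule diam_le)
      fix u v assume uv: "u \<in> {1..t}" "v \<in> {1..t}" "(u, v) \<in> (adj (merge m E))\<^sup>*"
      obtain r where r: "(u, r) \<in> adj (merge m E) ^^ depth (merge m E) u"
          "(v, r) \<in> adj (merge m E) ^^ depth (merge m E) v"
        by (rule common_root[of "merge m E" u v]) (use uniq uv(3) in blast)+
      have "(u, v) \<in> adj (merge m E) ^^ (depth (merge m E) u + depth (merge m E) v)"
        using r(1) adj_relpow_sym[OF r(2)] by (auto simp: relpow_add)
      moreover have "real (depth (merge m E) u + depth (merge m E) v) \<le> 4 * b * ln (real t)"
        using small_depths[OF b(1) _ small uv(1)] small_depths[OF b(1) _ small uv(2)] t assms by simp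
      ultimately show "\<exists>n. real n \<le> 4 * b * ln (real t) \<and> (u, v) \<in> adj (merge m E) ^^ n" by blast
    qed (use t in auto)
  qed
  with b(1) show ?thesis by (intro exI[of _ "4 * b"]) simp
qed

text \<open>Deterministic part: \<open>u\<close> and \<open>v\<close> descend to roots
  \<open>r\<close> and \<open>q\<close>, both at most \<open>K\<close>. These are connected, hence
  already connected by time \<open>S\<close>, and so at distance at most
  \<open>S * S \<le> ln t\<close>. The two descents contribute the \<open>4 * b\<close>.\<close>

lemma diam_good:
  assumes b: "b > 0" and t: "t \<ge> m" "real (S * S) \<le> ln (real t)"
    and E: "E \<in> set_pmf (M (m * t))"
    and small: "E \<notin> {E. \<exists>v\<in>{1..m * t}. real (bdepth E v) > b * ln (real (m * t))}"
    and roots: "E \<notin> (\<Union>j\<in>{K<..t}. root j)" and stable: "conn K E = conn K (early S E)"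
  shows "real (diam {1..t} (merge m E)) \<le> (4 * b + 1) * ln (real t)"
proof (rule diam_le)
  let ?F = "merge m E"
  have t1: "t \<ge> 1" "m * t \<ge> 1" using t(1) m by auto
  fix u v assume uv: "u \<in> {1..t}" "v \<in> {1..t}" "(u, v) \<in> (adj ?F)\<^sup>*"
  note path = depth_path[OF _ merged_edges_range[OF t1(1) E]]
  obtain r where r: "r \<in> {1..t}" "lower ?F r = {}" "(u, r) \<in> adj ?F ^^ depth ?F u" using path[OF uv(1)] .
  obtain q where q: "q \<in> {1..t}" "lower ?F q = {}" "(v, q) \<in> adj ?F ^^ depth ?F v" using path[OF uv(2)] .
  have "r \<le> K" "q \<le> K" using r q roots by (auto simp: root_def not_less[symmetric])
  moreover have "(r, q) \<in> (adj ?F)\<^sup>*"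
    using adj_rtrancl_sym[OF relpow_imp_rtrancl[OF r(3)]] uv(3) relpow_imp_rtrancl[OF q(3)] by simp
  ultimately have "(r, q) \<in> conn K E" using r(1) q(1) by (simp add: conn_def)
  then have "(r, q) \<in> conn K (early S E)" using stable by simp
  then obtain n where n: "n \<le> S * S" "(r, q) \<in> adj ?F ^^ n" using early_dist by blast
  have "(u, v) \<in> adj ?F ^^ (depth ?F u + n + depth ?F v)"
    using r(3) n(2) adj_relpow_sym[OF q(3)] by (auto simp: relpow_add)
  moreover have "real (depth ?F u + n + depth ?F v) \<le> (4 * b + 1) * ln (real t)"
  proof -
    have "real n \<le> ln (real t)" using n(1) t(2) of_nat_mono[OF n(1), where 'a = real] by linarith
    then show ?thesis
      using small_depths[OF b t(1) small uv(1)] small_depths[OF b t(1) small uv(2)] by (simp add: algebra_simps)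
  qed
  ultimately show "\<exists>n. real n \<le> (4 * b + 1) * ln (real t) \<and> (u, v) \<in> adj ?F ^^ n" by blast
qed (use t m in auto)

text \<open>The constant \<open>4 * b + 1\<close> is fixed before \<open>\<epsilon>\<close>.
  Although \<open>K\<close> and \<open>S\<close> depend on \<open>\<epsilon>\<close>, the distance
  \<open>S * S\<close> is eventually below \<open>ln t\<close>. Each of the three bad events in
  \<open>diam_good\<close> is given \<open>\<epsilon> / 3\<close>.\<close>

lemma diam_m2:
  assumes "m \<ge> 2"
  shows "\<exists>c>0. (\<lambda>t. measure_pmf.prob (M (m * t)) {E. real (diam {1..t} (merge m E)) \<le> c * ln (real t)}) \<longlonglongrightarrow> 1"
proof -
  obtain b where b: "b > 0" "(\<lambda>t. measure_pmf.prob (M (m * t))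
      {E. \<exists>v\<in>{1..m * t}. real (bdepth E v) > b * ln (real (m * t))}) \<longlonglongrightarrow> 0" by (rule bdepth_tail)
  define D where "D t = {E. \<exists>v\<in>{1..m * t}. real (bdepth E v) > b * ln (real (m * t))}" for t
  define B where "B t = {E. \<not> real (diam {1..t} (merge m E)) \<le> (4 * b + 1) * ln (real t)}" for t
  have "(\<lambda>t. measure_pmf.prob (M (m * t)) (B t)) \<longlonglongrightarrow> 0"
  proof (rule order_tendstoI)
    fix \<epsilon> :: real assume \<epsilon>: "0 < \<epsilon>"
    then have \<epsilon>3: "\<epsilon> / 3 > 0" by simp
    obtain K where K: "\<And>t. measure_pmf.prob (M (m * t)) (\<Union>j\<in>{K<..t}. root j) < \<epsilon> / 3"
      using prob_late_root[OF assms \<epsilon>3] by blast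
    \<comment> \<open>\<open>S\<close> is chosen after \<open>K\<close>, since it has to settle the
      connections among the first \<open>K\<close> blocks.\<close>
    obtain S where S: "\<And>t. t \<ge> S \<Longrightarrow> measure_pmf.prob (M t) {E. conn K E \<noteq> conn K (early S E)} < \<epsilon> / 3"
      using conn_stabilises[OF \<epsilon>3, of K] by blast
    have "\<forall>\<^sub>F t in sequentially. measure_pmf.prob (M (m * t)) (D t) < \<epsilon> / 3"
      using order_tendstoD(2)[OF b(2) \<epsilon>3] by (simp add: D_def)
    moreover have "filterlim (\<lambda>t. ln (real t)) at_top sequentially"
      by (rule filterlim_compose[OF ln_at_top filterlim_real_sequentially])
    then have "\<forall>\<^sub>F t in sequentially. real (S * S) \<le> ln (real t)"
      unfolding filterlim_at_top by blast
    ultimately show "\<forall>\<^sub>F t in sequentially. measure_pmf.prob (M (m * t)) (B t) < \<epsilon>"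
      using eventually_ge_at_top[of "max m S"]
    proof eventually_elim
      case (elim t)
      let ?R = "\<Union>j\<in>{K<..t}. root j" and ?C = "{E. conn K E \<noteq> conn K (early S E)}" and ?P = "measure_pmf.prob (M (m * t))"
      have "?P (B t) \<le> ?P (D t \<union> ?R \<union> ?C)"
        using diam_good[OF b(1), of t S _ K] elim
        by (intro measure_pmf.finite_measure_mono_AE) (auto simp: AE_measure_pmf_iff B_def D_def)
      also have "\<dots> \<le> ?P (D t) + ?P ?R + ?P ?C"
        using measure_Un_le[of "D t \<union> ?R" "measure_pmf (M (m * t))" ?C]
          measure_Un_le[of "D t" "measure_pmf (M (m * t))" ?R] by simp
      also have "S \<le> m * t" using elim m by (metis max.boundedE mult_le_mono nat_mult_1)
      then have "?P (D t) + ?P ?R + ?P ?C < \<epsilon>" using elim(1) K[of t] S[of "m * t"] by linarith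
      finally show ?case .
    qed
  next
    fix a :: real assume "a < 0"
    then show "\<forall>\<^sub>F t in sequentially. a < measure_pmf.prob (M (m * t)) (B t)"
      by (intro always_eventually allI) (rule less_le_trans[OF _ measure_nonneg])
  qed
  then have "(\<lambda>t. measure_pmf.prob (M (m * t)) {E. real (diam {1..t} (merge m E)) \<le> (4 * b + 1) * ln (real t)}) \<longlonglongrightarrow> 1"
    by (rule whp) (simp add: B_def)
  with b(1) show ?thesis by (intro exI[of _ "4 * b + 1"]) simp
qed

end

lemma PA_a_diam:
  assumes m: "m \<ge> 1" "\<delta> > - real m"
  shows "\<exists>c>0. (\<lambda>t. measure_pmf.prob (PA_a m \<delta> t) {G. real (diam {1..t} G) \<le> c * ln (real t)}) \<longlonglongrightarrow> 1"
proof -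
  interpret model_a m "\<delta> / real m" using m by unfold_locales (auto simp: field_simps)
  show ?thesis
    using diam_m1 diam_m2 m(1) by (cases "m = 1") (simp_all add: PA_a_def vimage_def)
qed

theorem theorem1p3:
  fixes m :: nat and \<delta> :: real
  assumes "m \<ge> 1" and "\<delta> > - real m"
    and "PA \<in> {PA_a, PA_b, PA_c}"
  shows "\<exists>c\<^sub>1 > 0. (\<lambda>t. measure_pmf.prob (PA m \<delta> t)
           {G. real (diam {1..t} G) \<le> c\<^sub>1 * ln (real t)}) \<longlonglongrightarrow> 1"
  using assms(3) PA_a_diam[OF assms(1,2)] PA_b_diam[OF assms(1,2)] PA_c_diam[OF assms(1,2)] by blast

end
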